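(* Let $m$ be a quasi-Bernoulli measure on $[0,1)^D$ with dimension $d=-\tau'(1)$. Suppose that there exists a real $\sigma>0$ such that $\tau(1-q)=qd+\frac{\sigma^2}{2}q^2+o(q^2)$ in a neighborhood of $q=0$. Then: (1) There exists a Borel set $E\subset\mathbb R^D$ such that $m(E)=1$ and $\mathcal H^d(E)=0$. In particular $m\perp\mathcal H^d$. (2) For every Borel set $E$, if $\widehat{\mathcal P}^d(E)<+\infty$ then $m(E)=0$. In particular $m\ll\widehat{\mathcal P}^d$.
   Context: Fix integers $D\ge1$, $\ell\ge2$. $\mathcal F_n$ is the family of $\ell$-adic cubes $\prod_{i=1}^D[k_i/\ell^n,(k_i+1)/\ell^n)$, $0\le k_i<\ell^n$. For each $n$ the cubes of $\mathcal F_n$ are coded bijectively as $I_{\varepsilon_1\cdots\varepsilon_n}$, $\varepsilon_i\in\{0,\dots,\ell^D-1\}$, with $I_{\varepsilon_1\cdots\varepsilon_{n+1}}\subset I_{\varepsilon_1\cdots\varepsilon_n}$. For $I=I_{\varepsilon_1\cdots\varepsilon_n}\in\mathcal F_n$ and $J=I_{\varepsilon_{n+1}\cdots\varepsilon_{n+p}}\in\mathcal F_p$, let $IJ=I_{\varepsilon_1\cdots\varepsilon_{n+p}}\in\mathcal F_{n+p}$. A Borel probability measure $m$ on $[0,1)^D$ is quasi-Bernoulli if there is a constant $C\ge1$ with $\frac1Cm(I)m(J)\le m(IJ)\le C\,m(I)m(J)$ for all $I,J\in\bigcup_n\mathcal F_n$. The $L^q$-spectrum is $\tau(q)=\limsup_{n\to\infty}\frac{1}{n\log\ell}\log\left(\sum_{I\in\mathcal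 F_n}m(I)^q\right)$, $q\in\mathbb R$ (sum over cubes with $m(I)>0$). For quasi-Bernoulli $m$ it is known that $\tau$ is convex and $C^1$ on $\mathbb R$, and that $d=-\tau'(1)$ is the dimension of $m$. $\mathcal H^s$ is the $s$-dimensional Hausdorff measure. The packing measure is $\widehat{\mathcal P}^s(E)=\inf\{\sum_i\mathcal P^s(E_i):E\subset\bigcup_iE_i\}$ (countable covers), where $\mathcal P^s(E)=\lim_{\eta\to0}\sup\{\sum_i|B_i|^s\}$, the supremum being over countable families of pairwise disjoint balls $B_i$ centered in $E$ with diameter $0<|B_i|\le\eta$. $m\perp\mathcal H^d$ means: there is a Borel set $E$ with $m(E)=1$ and $\mathcal H^d(E)=0$. $m\ll\widehat{\mathcal P}^d$ means: $\widehat{\mathcal P}^d(E)=0$ implies $m(E)=0$ for every Borel set $E$. *)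

theory Defs
  imports "HOL-Probability.Probability" "HOL-Library.Landau_Symbols"
begin

text \<open>
  The dimension of the ambient space is \<open>CARD('d)\<close>; the unit cube \<open>[0,1)\<close> to the power
  \<open>CARD('d)\<close> is the only element of generation \<open>0\<close>.
\<close>

definition unit_cube :: "(real ^ 'd) set" where
  "unit_cube = {x. \<forall>i. 0 \<le> x $ i \<and> x $ i < 1}"

definition adic_cube :: "nat \<Rightarrow> nat \<Rightarrow> ('d \<Rightarrow> nat) \<Rightarrow> (real ^ 'd) set" where
  "adic_cube l n k =
     {x. \<forall>i. real (k i) / real l ^ n \<le> x $ i \<and> x $ i < (real (k i) + 1) / real l ^ n}"

definition adic_cubes :: "nat \<Rightarrow> nat \<Rightarrow> (real ^ 'd) set set" where
  "adic_cubes l n = {adic_cube l n k |k. \<forall>i. k i < l ^ n}"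

definition words :: "nat \<Rightarrow> nat list set" where
  "words a = {w. set w \<subseteq> {..<a}}"

text \<open>
  A coding assigns to a word \<open>[e\<^sub>1, \<dots>, e\<^sub>n]\<close> the cube with index
  \<open>e\<^sub>1 \<dots> e\<^sub>n\<close>. Any bijective and nested coding is allowed.
\<close>

definition adic_coding :: "nat \<Rightarrow> (nat list \<Rightarrow> (real ^ 'd) set) \<Rightarrow> bool" where
  "adic_coding l c \<longleftrightarrow>
     (\<forall>n. bij_betw c {w \<in> words (l ^ CARD('d)). length w = n} (adic_cubes l n)) \<and>
     (\<forall>w \<in> words (l ^ CARD('d)). \<forall>e < l ^ CARD('d). c (w @ [e]) \<subseteq> c w)"

text \<open>
  A Borel measure on the unit cube is represented as a Borel measure on the whole space that
  gives full mass to the cube. The cube \<open>IJ\<close> is the one coded by the concatenated word.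
\<close>

definition quasi_bernoulli ::
  "nat \<Rightarrow> (nat list \<Rightarrow> (real ^ 'd) set) \<Rightarrow> (real ^ 'd) measure \<Rightarrow> bool" where
  "quasi_bernoulli l c m \<longleftrightarrow>
     prob_space m \<and> sets m = sets borel \<and> measure m unit_cube = 1 \<and>
     (\<exists>C\<ge>1. \<forall>u \<in> words (l ^ CARD('d)). \<forall>v \<in> words (l ^ CARD('d)).
        1 / C * measure m (c u) * measure m (c v) \<le> measure m (c (u @ v)) \<and>
        measure m (c (u @ v)) \<le> C * measure m (c u) * measure m (c v))"

text \<open>
  The upper limit is taken in the extended reals. For a quasi-Bernoulli measure the sums are
  positive and, up to bounded factors, multiplicative in \<open>n\<close>, so that it is finite and
  \<open>real_of_ereal\<close> loses nothing.
\<close>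

definition Lq_spectrum :: "nat \<Rightarrow> (real ^ 'd) measure \<Rightarrow> real \<Rightarrow> real" where
  "Lq_spectrum l m q =
     real_of_ereal (limsup (\<lambda>n. ereal (1 / (real n * ln (real l)) *
       ln (\<Sum>I \<in> {I \<in> adic_cubes l n. measure m I > 0}. measure m I powr q))))"

text \<open>
  In Isabelle \<open>0 powr 0 = 0\<close>, whereas a point has to contribute \<open>1\<close> to the measure of
  dimension \<open>0\<close>; hence the case distinctions. Boundedness of the covering sets is required
  because the library sets the diameter of an unbounded set to \<open>0\<close>.
\<close>

definition hausdorff_gauge :: "real \<Rightarrow> 'a::metric_space set \<Rightarrow> ennreal" where
  "hausdorff_gauge s U =
     (if U = {} then 0 else if s = 0 then 1 else ennreal (diameter U powr s))"

definition hausdorff_measure :: "real \<Rightarrow> 'a::metric_space set \<Rightarrow> ennreal" where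
  "hausdorff_measure s E =
     (SUP \<delta> \<in> {0::real<..}.
        INF U \<in> {U :: nat \<Rightarrow> 'a set. E \<subseteq> (\<Union>i. U i) \<and>
                   (\<forall>i. bounded (U i) \<and> diameter (U i) \<le> \<delta>)}.
          \<Sum>i. hausdorff_gauge s (U i))"

text \<open>
  The balls of a packing are taken closed; in a Euclidean space open balls give the same
  value, since the radii in a finite family can be shrunk by a factor close to \<open>1\<close>.
  The limit as \<open>\<eta>\<close> tends to \<open>0\<close> is an infimum because the suprema decrease with \<open>\<eta>\<close>.
\<close>

definition packings :: "real \<Rightarrow> 'a::metric_space set \<Rightarrow> 'a set set set" where
  "packings \<eta> E = {\<B>. countable \<B> \<and> disjoint \<B> \<and>
     (\<forall>B \<in> \<B>. (\<exists>x \<in> E. \<exists>r. B = cball x r) \<and> 0 < diameter B \<and> diameter B \<le> \<eta>)}"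

definition packing_premeasure :: "real \<Rightarrow> 'a::metric_space set \<Rightarrow> ennreal" where
  "packing_premeasure s E =
     (INF \<eta> \<in> {0::real<..}. SUP \<B> \<in> packings \<eta> E. \<Sum>\<^sub>\<infinity>B \<in> \<B>. ennreal (diameter B powr s))"

definition packing_measure :: "real \<Rightarrow> 'a::metric_space set \<Rightarrow> ennreal" where
  "packing_measure s E =
     (INF A \<in> {A :: nat \<Rightarrow> 'a set. E \<subseteq> (\<Union>i. A i)}. \<Sum>i. packing_premeasure s (A i))"

text \<open>
  Hausdorff and packing measures are set functions here, not of type \<open>measure\<close>, so the
  comparison with a Borel probability measure is stated for arbitrary set functions.
\<close>

definition singular_to :: "'a::topological_space measure \<Rightarrow> ('a set \<Rightarrow> ennreal) \<Rightarrow> bool" where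
  "singular_to m \<mu> \<longleftrightarrow> (\<exists>E \<in> sets borel. measure m E = 1 \<and> \<mu> E = 0)"

definition abs_cont_to :: "'a::topological_space measure \<Rightarrow> ('a set \<Rightarrow> ennreal) \<Rightarrow> bool" where
  "abs_cont_to m \<mu> \<longleftrightarrow> (\<forall>E \<in> sets borel. \<mu> E = 0 \<longrightarrow> measure m E = 0)"

end

theory Submission
  imports Defs "HOL-Real_Asymp.Real_Asymp"
begin

text \<open>
  Write \<open>\<mu> w\<close> for the mass of the cube coded by \<open>w\<close>, \<open>\<tau>\<close> for the spectrum, and, for a word of length
  \<open>n\<close>, let \<open>S = - ln (\<mu> w) - n * d * ln l\<close>. Both assertions say that \<open>S\<close>, seen as a function of a random
  point, oscillates without bound: where \<open>S\<close> is very negative, cubes are much heavier than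
  \<open>l powr (- d * n)\<close> and cover cheaply; where it is very positive, small balls have much
  less mass than the \<open>d\<close>-th power of their diameter.

  The sum of \<open>\<mu> w powr (1 - q)\<close> over the words of length \<open>n\<close> is the moment generating function of \<open>S\<close> up to
  normalisation. By the quasi-Bernoulli property it is multiplicative in \<open>n\<close> up to bounded factors, so
  it equals \<open>l powr (n * \<tau> (1 - q))\<close> up to a factor that is bounded uniformly in \<open>n\<close> and small \<open>q\<close>
  (\<open>ln_Z_spectrum\<close>). At \<open>q = t / sqrt n\<close> the quadratic expansion of \<open>\<tau>\<close> turns this into Gaussian-like
  exponential moments of \<open>S / sqrt n\<close>, and a second moment argument shows that \<open>S \<ge> sqrt n\<close>
  and \<open>S \<le> - sqrt n\<close> both have mass bounded below for large \<open>n\<close> (\<open>deviation_lower_bound\<close>).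

  Again by the quasi-Bernoulli property, below every cube of positive mass the measure looks like \<open>m\<close> up to
  the factor \<open>C\<close>. So after any initial word each of the two events has conditional mass
  bounded below at some later generation, and almost every point sees both of them infinitely often
  (\<open>AE_infinitely_often_good\<close>). The gain \<open>exp (sqrt n)\<close> exceeds every power of \<open>n\<close>; the factor \<open>n ^ 3\<close>
  is kept.

  For the Hausdorff measure, the first heavy cubes form disjoint covers whose gauge sums tend to zero
  (\<open>hausdorff_measure_heavy_eq_0\<close>). For the packing measure, balls have to replace cubes. Almost surely a
  ball centred in a cube of generation \<open>n\<close> and of radius \<open>1 / l ^ n\<close> has eventually at most \<open>n\<^sup>2\<close> times the
  mass of the cube, by a Borel--Cantelli argument (\<open>AE_neighbourhood_comparable\<close>). So almost every point
  is the centre of arbitrarily small balls whose fivefold enlargement is as light as desired,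
  and the Vitali covering lemma yields that a set with finite packing measure is null
  (\<open>null_of_finite_packing_measure\<close>).
\<close>

section \<open>Adic cubes and their coding\<close>

text \<open>
  With integer coordinates the cubes of generation \<open>n\<close> are the level sets of one function, on the
  whole space and not only on the unit cube. Disjointness is then immediate, and the translates
  of a cube, which surround it and may leave the unit cube, are described in the same way.
\<close>

definition cell :: "nat \<Rightarrow> nat \<Rightarrow> real ^ 'd \<Rightarrow> 'd \<Rightarrow> int" where
  "cell l n x i = \<lfloor>x $ i * real l ^ n\<rfloor>"

lemma adic_cube_eq_cell:
  assumes "l \<ge> 1"
  shows "adic_cube l n k = {x. cell l n x = (\<lambda>i. int (k i))}"
proof -
  have "(0::real) < real l ^ n" using assms by simp
  then show ?thesis
    by (auto simp: adic_cube_def cell_def fun_eq_iff floor_eq_iff field_simps)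
qed

lemma measurable_cell: "(cell l n :: real ^ 'd \<Rightarrow> _) -` {k} \<in> sets borel"
proof -
  have "(cell l n :: real ^ 'd \<Rightarrow> _) -` {k} = (\<Inter>i. {x. \<lfloor>x $ i * real l ^ n\<rfloor> = k i})"
    by (auto simp: cell_def fun_eq_iff)
  also have "\<dots> = (\<Inter>i. {x \<in> space borel. of_int (k i) \<le> x $ i * real l ^ n \<and>
      x $ i * real l ^ n < of_int (k i) + 1})"
    by (simp add: floor_eq_iff)
  also have "\<dots> \<in> sets borel"
    by (intro sets.countable_INT'') auto
  finally show ?thesis .
qed

lemma cell_cball:
  assumes "l \<ge> 1" "y \<in> cball x (1 / real l ^ n)"
  shows "\<bar>cell l n y i - cell l n x i\<bar> \<le> 1"
proof -
  have pos: "(0::real) < real l ^ n" using assms by simp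
  have "\<bar>y $ i - x $ i\<bar> \<le> 1 / real l ^ n"
    using assms(2) component_le_norm_cart[of "y - x" i] by (simp add: dist_norm norm_minus_commute)
  then have "\<bar>y $ i - x $ i\<bar> * real l ^ n \<le> 1"
    using pos by (simp add: field_simps)
  then have "\<bar>y $ i * real l ^ n - x $ i * real l ^ n\<bar> \<le> 1"
    using pos by (simp add: abs_mult flip: left_diff_distrib)
  then show ?thesis unfolding cell_def by linarith
qed

lemma diameter_adic_cube:
  assumes "l \<ge> 1"
  shows "bounded (adic_cube l n k :: (real ^ 'd) set)"
    and "diameter (adic_cube l n k :: (real ^ 'd) set) \<le> real CARD('d) / real l ^ n"
proof -
  have pos: "(0::real) < real l ^ n" using assms by simp
  have *: "dist x y \<le> real CARD('d) / real l ^ n"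
    if "x \<in> adic_cube l n k" "y \<in> adic_cube l n k" for x y :: "real ^ 'd"
  proof -
    have "\<bar>(x - y) $ i\<bar> \<le> 1 / real l ^ n" for i
    proof -
      have "real (k i) / real l ^ n \<le> x $ i" "x $ i < (real (k i) + 1) / real l ^ n"
           "real (k i) / real l ^ n \<le> y $ i" "y $ i < (real (k i) + 1) / real l ^ n"
        using that by (auto simp: adic_cube_def)
      then show ?thesis by (simp add: add_divide_distrib abs_le_iff)
    qed
    then have "(\<Sum>i\<in>UNIV. \<bar>(x - y) $ i\<bar>) \<le> (\<Sum>i\<in>(UNIV::'d set). 1 / real l ^ n)"
      by (intro sum_mono) auto
    then show ?thesis
      using norm_le_l1_cart[of "x - y"] by (simp add: dist_norm)
  qed
  show "bounded (adic_cube l n k :: (real ^ 'd) set)"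
    unfolding bounded_two_points using * by blast
  show "diameter (adic_cube l n k :: (real ^ 'd) set) \<le> real CARD('d) / real l ^ n"
    using pos * by (intro diameter_le) (auto simp: dist_norm)
qed

definition level_words :: "nat \<Rightarrow> nat \<Rightarrow> nat list set" where
  "level_words a n = {w \<in> words a. length w = n}"

lemma finite_level_words: "finite (level_words a n)"
  unfolding level_words_def words_def
  by (rule finite_subset[OF _ finite_lists_length_eq[of "{..<a}" n]]) auto

lemma level_words_append:
  "u \<in> level_words a n \<Longrightarrow> v \<in> level_words a p \<Longrightarrow> u @ v \<in> level_words a (n + p)"
  by (auto simp: level_words_def words_def)

lemma bij_betw_level_words_append:
  "bij_betw (\<lambda>(u, v). u @ v) (level_words a n \<times> level_words a p) (level_words a (n + p))"
proof (rule bij_betwI[where g = "\<lambda>w. (take n w, drop n w)"])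
  show "(\<lambda>w. (take n w, drop n w)) \<in> level_words a (n + p) \<rightarrow> level_words a n \<times> level_words a p"
    by (auto simp: level_words_def words_def dest: in_set_takeD in_set_dropD)
qed (auto simp: level_words_def words_def)

lemma sum_level_words_append:
  "(\<Sum>w\<in>level_words a (n + p). f w) =
    (\<Sum>u\<in>level_words a n. \<Sum>v\<in>level_words a p. f (u @ v) :: 'b :: comm_monoid_add)"
  unfolding sum.cartesian_product sum.reindex_bij_betw[OF bij_betw_level_words_append, symmetric]
  by (simp add: case_prod_unfold)

text \<open>
  The size \<open>a\<close> of the alphabet is a parameter of its own so that sets of words do not depend on
  the type of the points.
\<close>

locale quasi_bernoulli_coding =
  fixes l a :: nat
    and c :: "nat list \<Rightarrow> (real ^ 'd) set"
    and m :: "(real ^ 'd) measure"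
    and C :: real
  assumes l: "l \<ge> 2"
    and a: "a = l ^ CARD('d)"
    and coding: "adic_coding l c"
    and prob: "prob_space m"
    and sets_m: "sets m = sets borel"
    and unit_cube: "measure m unit_cube = 1"
    and C: "C \<ge> 1"
    and quasi: "u \<in> words a \<Longrightarrow> v \<in> words a \<Longrightarrow>
      1 / C * measure m (c u) * measure m (c v) \<le> measure m (c (u @ v)) \<and>
      measure m (c (u @ v)) \<le> C * measure m (c u) * measure m (c v)"
begin

sublocale prob_space m by (rule prob)

lemma space_m: "space m = UNIV"
  using sets_eq_imp_space_eq[OF sets_m] by simp

lemma l_pos: "real l ^ n > 0"
  using l by simp

lemma ln_l: "ln (real l) > 0"
  using l by simp

abbreviation W :: "nat \<Rightarrow> nat list set" where
  "W \<equiv> level_words a"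

abbreviation \<mu> :: "nat list \<Rightarrow> real" where
  "\<mu> w \<equiv> measure m (c w)"

lemma bij_c: "bij_betw c (W n) (adic_cubes l n)"
  using coding by (simp add: adic_coding_def level_words_def a)

lemma cube_of_word:
  assumes "w \<in> W n"
  obtains k where "c w = adic_cube l n k"
  using bij_betwE[OF bij_c] assms unfolding adic_cubes_def by blast

lemma cube_eq_vimage:
  assumes "w \<in> W n"
  obtains k where "c w = cell l n -` {k}"
proof -
  obtain k where "c w = adic_cube l n k" using cube_of_word[OF assms] .
  then have "c w = cell l n -` {\<lambda>i. int (k i)}"
    using l by (auto simp: adic_cube_eq_cell)
  then show ?thesis by (rule that)
qed

lemma same_cell:
  assumes "w \<in> W n" "x \<in> c w"
  shows "y \<in> c w \<longleftrightarrow> cell l n y = cell l n x"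
  using cube_eq_vimage[OF assms(1)] assms(2) by (metis vimage_singleton_eq)

lemma sets_cube [measurable]: "w \<in> W n \<Longrightarrow> c w \<in> sets m"
  using cube_eq_vimage[of w n] measurable_cell sets_m by metis

lemma cubes_disjoint:
  assumes "u \<in> W n" "v \<in> W n" "x \<in> c u" "x \<in> c v"
  shows "u = v"
proof -
  have "c u = c v"
    using same_cell assms by blast
  then show ?thesis
    using bij_c[of n] assms(1,2) by (auto simp: bij_betw_def inj_on_def)
qed

lemma cubes_cover_unit_cube:
  assumes "x \<in> unit_cube"
  obtains w where "w \<in> W n" "x \<in> c w"
proof -
  define k where "k i = nat (cell l n x i)" for i
  have cell: "cell l n x i \<ge> 0" "nat (cell l n x i) < l ^ n" for i
  proof -
    have x: "0 \<le> x $ i" "x $ i < 1" using assms by (auto simp: unit_cube_def)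
    then show ge: "cell l n x i \<ge> 0"
      by (simp add: cell_def)
    have "x $ i * real l ^ n < 1 * real l ^ n"
      using x l_pos by (intro mult_strict_right_mono) auto
    then have "cell l n x i < int (l ^ n)"
      by (simp add: cell_def floor_less_iff)
    then show "nat (cell l n x i) < l ^ n"
      using ge by (metis int_nat_eq of_nat_less_iff)
  qed
  have "adic_cube l n k \<in> adic_cubes l n"
    using cell by (auto simp: adic_cubes_def k_def)
  then obtain w where "w \<in> W n" "c w = adic_cube l n k"
    using bij_betw_imp_surj_on[OF bij_c, of n] by (metis imageE)
  moreover have "x \<in> adic_cube l n k"
    using l cell by (auto simp: adic_cube_eq_cell k_def fun_eq_iff)
  ultimately show ?thesis using that by metis
qed

lemma cube_append_subset:
  "u \<in> words a \<Longrightarrow> v \<in> words a \<Longrightarrow> c (u @ v) \<subseteq> c u"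
proof (induction v rule: rev_induct)
  case (snoc e v)
  then have "u @ v \<in> words a" "e < a" "v \<in> words a"
    by (auto simp: words_def)
  then have "c ((u @ v) @ [e]) \<subseteq> c (u @ v)"
    using coding unfolding adic_coding_def a by blast
  then show ?case using snoc \<open>v \<in> _\<close> by auto
qed simp

lemma cube_subset_unit_cube:
  assumes "w \<in> W n"
  shows "c w \<subseteq> unit_cube"
proof -
  have "c [] = unit_cube"
  proof -
    have "[] \<in> W 0" by (simp add: level_words_def words_def)
    then have "c [] \<in> adic_cubes l 0" using bij_betwE[OF bij_c] by blast
    then show ?thesis
      by (auto simp: adic_cubes_def adic_cube_def unit_cube_def)
  qed
  then show ?thesis
    using cube_append_subset[of "[]" w] assms by (simp add: level_words_def words_def)
qed

text \<open>
  Nestedness gives only one inclusion. For the other one, a point of \<open>c u\<close> lies in some cube of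
  generation \<open>n + p\<close>; the prefix of length \<open>n\<close> of its word codes a cube that meets \<open>c u\<close>, and
  cubes of the same generation that meet are equal.
\<close>

lemma cube_eq_UN:
  assumes u: "u \<in> W n"
  shows "c u = (\<Union>v\<in>W p. c (u @ v))"
proof
  show "(\<Union>v\<in>W p. c (u @ v)) \<subseteq> c u"
    using cube_append_subset u by (fastforce simp: level_words_def)
  show "c u \<subseteq> (\<Union>v\<in>W p. c (u @ v))"
  proof
    fix x assume x: "x \<in> c u"
    then obtain w where w: "w \<in> W (n + p)" "x \<in> c w"
      using cubes_cover_unit_cube cube_subset_unit_cube[OF u] by blast
    then have "w \<in> (\<lambda>(u, v). u @ v) ` (W n \<times> W p)"
      using bij_betw_imp_surj_on[OF bij_betw_level_words_append] by metis
    then obtain u' v where uv: "u' \<in> W n" "v \<in> W p" "w = u' @ v"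
      by auto
    then have "x \<in> c u'"
      using cube_append_subset[of u' v] w by (auto simp: level_words_def)
    then have "u' = u" using cubes_disjoint[OF uv(1) u _ x] by simp
    then show "x \<in> (\<Union>v\<in>W p. c (u @ v))" using uv w by auto
  qed
qed

lemma unit_cube_eq_UN: "unit_cube = (\<Union>w\<in>W n. c w)"
proof
  show "unit_cube \<subseteq> (\<Union>w\<in>W n. c w)"
    using cubes_cover_unit_cube[of _ n] by blast
qed (use cube_subset_unit_cube in blast)

lemma disjoint_family_cubes: "disjoint_family_on c (W n)"
  using cubes_disjoint by (auto simp: disjoint_family_on_def)

lemma disjoint_family_append:
  assumes "u \<in> W n"
  shows "disjoint_family_on (\<lambda>v. c (u @ v)) (W p)"
  using cubes_disjoint[OF level_words_append[OF assms] level_words_append[OF assms]]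
  by (auto simp: disjoint_family_on_def)

lemma measure_Int_cube:
  assumes u: "u \<in> W n" and A: "A \<in> sets m"
  shows "measure m (c u \<inter> A) = (\<Sum>v\<in>W p. measure m (c (u @ v) \<inter> A))"
proof -
  have "c u \<inter> A = (\<Union>v\<in>W p. c (u @ v) \<inter> A)"
    using cube_eq_UN[OF u, of p] by auto
  also have "measure m \<dots> = (\<Sum>v\<in>W p. measure m (c (u @ v) \<inter> A))"
  proof (intro measure_finite_Union finite_level_words)
    show "(\<lambda>v. c (u @ v) \<inter> A) ` W p \<subseteq> sets m"
      using sets_cube level_words_append[OF u] A by (auto intro!: sets.Int)
    show "disjoint_family_on (\<lambda>v. c (u @ v) \<inter> A) (W p)"
      using disjoint_family_append[OF u, of p] unfolding disjoint_family_on_def by blast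
  qed auto
  finally show ?thesis .
qed

lemma sum_cubes: "(\<Sum>w\<in>W n. \<mu> w) = 1"
proof -
  have "measure m (\<Union>w\<in>W n. c w) = (\<Sum>w\<in>W n. \<mu> w)"
    using sets_cube disjoint_family_cubes by (intro measure_finite_Union finite_level_words) auto
  then show ?thesis using unit_cube unit_cube_eq_UN[of n] by simp
qed

lemma sum_cube_append:
  assumes "u \<in> W n"
  shows "\<mu> u = (\<Sum>v\<in>W p. \<mu> (u @ v))"
  using measure_Int_cube[OF assms sets.top] space_m by simp

lemma quasi_words:
  assumes "u \<in> W n" "v \<in> W p"
  shows "\<mu> u * \<mu> v / C \<le> \<mu> (u @ v)" "\<mu> (u @ v) \<le> C * (\<mu> u * \<mu> v)"
  using quasi[of u v] assms by (auto simp: level_words_def mult_ac)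


section \<open>Recurrence of cylinder events\<close>

text \<open>
  The points of the unit cube that lie in no cube with a word in \<open>G\<close> from generation \<open>n\<close> on. That
  almost every point is in infinitely many cubes of \<open>G\<close> means that all these sets are null.
\<close>

definition late_bad_set :: "nat list set \<Rightarrow> nat \<Rightarrow> (real ^ 'd) set" where
  "late_bad_set G n = unit_cube - (\<Union>N\<in>{n..}. \<Union>w\<in>W N \<inter> G. c w)"

lemma sets_unit_cube: "unit_cube \<in> sets m"
  unfolding unit_cube_eq_UN[of 0] using sets_cube finite_level_words by (intro sets.finite_UN) auto

lemma sets_good: "(\<Union>w\<in>W N \<inter> G. c w) \<in> sets m"
  using sets_cube finite_level_words by (intro sets.finite_UN) auto

lemma sets_late_bad_set: "late_bad_set G n \<in> sets m"
  unfolding late_bad_set_def using sets_unit_cube sets_good by (intro sets.Diff sets.countable_UN') auto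

text \<open>
  Suppose that below every cube a fixed proportion \<open>\<delta>\<close> of the mass is caught by cubes of \<open>G\<close> at some
  deeper generation. What has escaped below \<open>u\<close> is carried by subcubes outside \<open>G\<close>, to each of
  which the same argument applies, so every round leaves at most the fraction \<open>1 - \<delta>\<close>.
\<close>

lemma measure_late_bad_set_le:
  assumes step: "\<And>n. \<exists>p\<ge>1. \<forall>u\<in>W n. (\<Sum>v | v \<in> W p \<and> u @ v \<in> G. \<mu> (u @ v)) \<ge> \<delta> * \<mu> u"
    and \<delta>: "0 < \<delta>" "\<delta> \<le> 1"
    and u: "u \<in> W n"
  shows "measure m (c u \<inter> late_bad_set G (Suc n)) \<le> (1 - \<delta>) ^ k * \<mu> u"
  using u
proof (induction k arbitrary: u n)
  case 0
  then show ?case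
    using sets_cube by (auto intro!: finite_measure_mono)
next
  case (Suc k)
  obtain p where p: "p \<ge> 1" "(\<Sum>v | v \<in> W p \<and> u @ v \<in> G. \<mu> (u @ v)) \<ge> \<delta> * \<mu> u"
    using step Suc.prems by blast
  have split: "(\<Sum>v\<in>W p. f v) = (\<Sum>v | v \<in> W p \<and> u @ v \<in> G. f v) + (\<Sum>v | v \<in> W p \<and> u @ v \<notin> G. f v)"
    for f :: "nat list \<Rightarrow> real"
    using finite_level_words by (subst sum.union_disjoint[symmetric]) (auto intro: sum.cong)
  have good: "measure m (c (u @ v) \<inter> late_bad_set G (Suc n)) = 0" if "v \<in> W p" "u @ v \<in> G" for v
  proof -
    have "c (u @ v) \<inter> late_bad_set G (Suc n) = {}"
      using that level_words_append[OF Suc.prems that(1)] p(1)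
      by (force simp: late_bad_set_def)
    then show ?thesis by simp
  qed
  have bad: "measure m (c (u @ v) \<inter> late_bad_set G (Suc n)) \<le> (1 - \<delta>) ^ k * \<mu> (u @ v)" if "v \<in> W p" for v
  proof -
    have "late_bad_set G (Suc n) \<subseteq> late_bad_set G (Suc (n + p))"
      by (force simp: late_bad_set_def)
    then have "measure m (c (u @ v) \<inter> late_bad_set G (Suc n)) \<le>
        measure m (c (u @ v) \<inter> late_bad_set G (Suc (n + p)))"
      using sets_cube[OF level_words_append[OF Suc.prems that]] sets_late_bad_set
      by (intro finite_measure_mono) auto
    also have "\<dots> \<le> (1 - \<delta>) ^ k * \<mu> (u @ v)"
      by (rule Suc.IH[OF level_words_append[OF Suc.prems that]])
    finally show ?thesis .
  qed
  have "measure m (c u \<inter> late_bad_set G (Suc n)) = (\<Sum>v\<in>W p. measure m (c (u @ v) \<inter> late_bad_set G (Suc n)))"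
    by (rule measure_Int_cube[OF Suc.prems sets_late_bad_set])
  also have "\<dots> = (\<Sum>v | v \<in> W p \<and> u @ v \<notin> G. measure m (c (u @ v) \<inter> late_bad_set G (Suc n)))"
    unfolding split using good by simp
  also have "\<dots> \<le> (\<Sum>v | v \<in> W p \<and> u @ v \<notin> G. (1 - \<delta>) ^ k * \<mu> (u @ v))"
    using bad by (intro sum_mono) auto
  also have "\<dots> = (1 - \<delta>) ^ k * (\<mu> u - (\<Sum>v | v \<in> W p \<and> u @ v \<in> G. \<mu> (u @ v)))"
    unfolding sum_cube_append[OF Suc.prems, of p] split by (simp add: sum_distrib_left)
  also have "\<dots> \<le> (1 - \<delta>) ^ k * (\<mu> u - \<delta> * \<mu> u)"
    using p \<delta> by (intro mult_left_mono) auto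
  also have "\<dots> = (1 - \<delta>) ^ Suc k * \<mu> u"
    by (simp add: algebra_simps)
  finally show ?case .
qed

text \<open>
  This is a Borel--Cantelli lemma without independence, and it replaces a zero-one law. The depth
  \<open>p\<close> may depend on \<open>n\<close>, but not on the cube \<open>u\<close> of that generation.
\<close>

lemma AE_infinitely_often_good:
  assumes step: "\<And>n. \<exists>p\<ge>1. \<forall>u\<in>W n. (\<Sum>v | v \<in> W p \<and> u @ v \<in> G. \<mu> (u @ v)) \<ge> \<delta> * \<mu> u"
    and \<delta>: "0 < \<delta>" "\<delta> \<le> 1"
  shows "AE x in m. \<forall>n. \<exists>N\<ge>n. \<exists>w\<in>W N \<inter> G. x \<in> c w"
proof -
  have null: "measure m (late_bad_set G (Suc n)) = 0" for n
  proof -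
    have le: "measure m (c u \<inter> late_bad_set G (Suc n)) \<le> 0" if "u \<in> W n" for u
    proof (rule LIMSEQ_le_const)
      show "(\<lambda>k. (1 - \<delta>) ^ k * \<mu> u) \<longlonglongrightarrow> 0"
        using \<delta> by (intro tendsto_mult_left_zero LIMSEQ_power_zero) auto
      show "\<exists>N. \<forall>k\<ge>N. measure m (c u \<inter> late_bad_set G (Suc n)) \<le> (1 - \<delta>) ^ k * \<mu> u"
        using measure_late_bad_set_le[OF step \<delta> that] by blast
    qed
    have "measure m (late_bad_set G (Suc n)) = measure m (\<Union>u\<in>W n. c u \<inter> late_bad_set G (Suc n))"
      using unit_cube_eq_UN[of n] by (intro arg_cong[where f = "measure m"]) (auto simp: late_bad_set_def)
    also have "\<dots> \<le> (\<Sum>u\<in>W n. measure m (c u \<inter> late_bad_set G (Suc n)))"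
      using sets_cube sets_late_bad_set
      by (intro finite_measure_subadditive_finite finite_level_words) auto
    also have "\<dots> \<le> (\<Sum>u\<in>W n. 0)"
      using le by (intro sum_mono)
    finally show ?thesis
      using measure_nonneg[of m "late_bad_set G (Suc n)"] by simp
  qed
  have "AE x in m. \<forall>n. x \<notin> late_bad_set G (Suc n)"
    using null sets_late_bad_set by (auto simp: AE_all_countable emeasure_eq_measure intro!: AE_not_in null_setsI)
  moreover have "AE x in m. x \<in> unit_cube"
    using unit_cube sets_unit_cube by (subst AE_in_set_eq_1) auto
  ultimately show ?thesis
  proof eventually_elim
    fix x assume x: "\<forall>n. x \<notin> late_bad_set G (Suc n)" "x \<in> unit_cube"
    show "\<forall>n. \<exists>N\<ge>n. \<exists>w\<in>W N \<inter> G. x \<in> c w"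
    proof
      fix n
      have "x \<notin> late_bad_set G (Suc n)" using x by blast
      then obtain N where "N \<ge> Suc n" "\<exists>w\<in>W N \<inter> G. x \<in> c w"
        using x(2) by (auto simp: late_bad_set_def)
      then show "\<exists>N\<ge>n. \<exists>w\<in>W N \<inter> G. x \<in> c w"
        by (intro exI[of _ N]) auto
    qed
  qed
qed

text \<open>
  The quasi-Bernoulli property says that the measure seen inside a cube of positive mass is, up to
  the factor \<open>C\<close>, the original measure. So an event that has mass \<open>\<delta>\<close> from the start has
  conditional mass at least \<open>\<delta> / C\<close> below every cube.
\<close>

lemma quasi_mass_step:
  assumes u: "u \<in> W n" and G: "\<And>v. v \<in> W p \<Longrightarrow> v \<in> H \<Longrightarrow> \<mu> u > 0 \<Longrightarrow> u @ v \<in> G"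
    and mass: "(\<Sum>v\<in>W p \<inter> H. \<mu> v) \<ge> \<delta>"
  shows "(\<Sum>v | v \<in> W p \<and> u @ v \<in> G. \<mu> (u @ v)) \<ge> \<delta> / C * \<mu> u"
proof (cases "\<mu> u > 0")
  case True
  have "\<delta> / C * \<mu> u \<le> (\<Sum>v\<in>W p \<inter> H. \<mu> v) / C * \<mu> u"
    using mass C by (intro mult_right_mono divide_right_mono) auto
  also have "\<dots> = (\<Sum>v\<in>W p \<inter> H. \<mu> u * \<mu> v / C)"
    by (simp add: sum_distrib_left sum_divide_distrib mult_ac)
  also have "\<dots> \<le> (\<Sum>v\<in>W p \<inter> H. \<mu> (u @ v))"
    using quasi_words[OF u] by (intro sum_mono) auto
  also have "\<dots> \<le> (\<Sum>v | v \<in> W p \<and> u @ v \<in> G. \<mu> (u @ v))"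
    using finite_level_words G True by (intro sum_mono2) auto
  finally show ?thesis .
next
  case False
  then have "\<mu> u = 0" using measure_nonneg[of m "c u"] by linarith
  then show ?thesis by (simp add: sum_nonneg)
qed

text \<open>
  Fluctuations of order \<open>sqrt p\<close> in the logarithm absorb whatever was lost in the first \<open>n\<close> digits and
  still leave a power of the generation to spare. The cube is what the later arguments consume: a square
  for the comparison of balls with cubes, and one more factor tending to infinity.
\<close>

lemma exp_sqrt_beats_cube:
  fixes A :: real
  shows "\<exists>p\<ge>p0. p \<ge> 1 \<and> A * (real n + real p) ^ 3 \<le> exp (sqrt (real p))"
proof -
  have "((\<lambda>p. A * (real n + real p) ^ 3 / exp (sqrt (real p))) \<longlongrightarrow> 0) sequentially"
    by real_asymp
  then have "eventually (\<lambda>p. A * (real n + real p) ^ 3 / exp (sqrt (real p)) < 1) sequentially"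
    by (rule order_tendstoD) simp
  then have "eventually (\<lambda>p. A * (real n + real p) ^ 3 / exp (sqrt (real p)) < 1 \<and> p \<ge> max p0 1) sequentially"
    using eventually_ge_at_top by (rule eventually_conj)
  then obtain p where "A * (real n + real p) ^ 3 / exp (sqrt (real p)) < 1 \<and> p \<ge> max p0 1"
    using eventually_happens'[OF sequentially_bot] by blast
  then show ?thesis by (intro exI[of _ p]) (auto simp: divide_less_eq)
qed

text \<open>
  If cubes that are heavier than \<open>l powr (- d * p)\<close> by the factor \<open>exp (sqrt p)\<close> carry a fixed share
  of the mass at every large generation, then almost every point lies in infinitely many heavy
  cubes. Finitely many digits in front change the mass by a bounded factor only, because the
  positive masses of a given generation have a positive minimum.
\<close>

lemma AE_infinitely_often_heavy_cube:
  assumes mass: "\<And>p. p \<ge> p0 \<Longrightarrow>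
      (\<Sum>v\<in>W p \<inter> {v. \<mu> v \<ge> exp (sqrt (real p)) * real l powr (- d * real p)}. \<mu> v) \<ge> \<delta>"
    and \<delta>: "0 < \<delta>" "\<delta> \<le> 1"
  shows "AE x in m. \<forall>n. \<exists>N\<ge>n. \<exists>w\<in>W N.
      \<mu> w \<ge> real N ^ 3 * real l powr (- d * real N) \<and> x \<in> c w"
proof -
  define G where "G = {w. \<mu> w \<ge> real (length w) ^ 3 * real l powr (- d * real (length w))}"
  have "\<exists>p\<ge>1. \<forall>u\<in>W n. (\<Sum>v | v \<in> W p \<and> u @ v \<in> G. \<mu> (u @ v)) \<ge> \<delta> / C * \<mu> u" for n
  proof -
    define \<mu>min where "\<mu>min = Min (insert 1 (\<mu> ` {u \<in> W n. \<mu> u > 0}))"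
    have min_pos: "\<mu>min > 0"
      unfolding \<mu>min_def using finite_level_words by (subst Min_gr_iff) auto
    obtain p where p: "p \<ge> p0" "p \<ge> 1"
      "C * real l powr (- d * real n) / \<mu>min * (real n + real p) ^ 3 \<le> exp (sqrt (real p))"
      using exp_sqrt_beats_cube by blast
    have "(\<Sum>v | v \<in> W p \<and> u @ v \<in> G. \<mu> (u @ v)) \<ge> \<delta> / C * \<mu> u" if u: "u \<in> W n" for u
    proof (rule quasi_mass_step[OF u _ mass[OF p(1)]])
      fix v assume v: "v \<in> W p" "v \<in> {v. \<mu> v \<ge> exp (sqrt (real p)) * real l powr (- d * real p)}"
        and pos: "\<mu> u > 0"
      have len: "length (u @ v) = n + p" using u v(1) by (simp add: level_words_def)
      have "\<mu>min \<le> \<mu> u"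
        unfolding \<mu>min_def using finite_level_words u pos by (intro Min_le) auto
      have "(real n + real p) ^ 3 * real l powr (- d * (real n + real p)) =
          (C * real l powr (- d * real n) / \<mu>min * (real n + real p) ^ 3) * real l powr (- d * real p) * (\<mu>min / C)"
        using min_pos C l by (simp add: powr_add[symmetric] algebra_simps)
      also have "\<dots> \<le> exp (sqrt (real p)) * real l powr (- d * real p) * (\<mu>min / C)"
        using p(3) min_pos C by (intro mult_right_mono) auto
      also have "\<dots> \<le> \<mu> v * (\<mu> u / C)"
        using v(2) min_pos C \<open>\<mu>min \<le> \<mu> u\<close> by (intro mult_mono divide_right_mono) auto
      also have "\<dots> \<le> \<mu> (u @ v)"
        using quasi_words(1)[OF u v(1)] by (simp add: mult_ac)
      finally show "u @ v \<in> G" unfolding G_def using len by simp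
    qed
    then show ?thesis using p(2) by blast
  qed
  then have "AE x in m. \<forall>n. \<exists>N\<ge>n. \<exists>w\<in>W N \<inter> G. x \<in> c w"
    using \<delta> C by (intro AE_infinitely_often_good[where \<delta> = "\<delta> / C"]) (auto simp: divide_le_eq)
  then show ?thesis
    by eventually_elim (fastforce simp: G_def level_words_def)
qed

text \<open>
  The counterpart for light cubes. Here the prefix costs nothing except \<open>C\<close>, since its mass is at most 1.
\<close>

lemma AE_infinitely_often_light_cube:
  assumes mass: "\<And>p. p \<ge> p0 \<Longrightarrow>
      (\<Sum>v\<in>W p \<inter> {v. exp (sqrt (real p)) * \<mu> v \<le> real l powr (- d * real p)}. \<mu> v) \<ge> \<delta>"
    and \<delta>: "0 < \<delta>" "\<delta> \<le> 1"
  shows "AE x in m. \<forall>n. \<exists>N\<ge>n. \<exists>w\<in>W N.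
      real N ^ 3 * \<mu> w \<le> real l powr (- d * real N) \<and> x \<in> c w"
proof -
  define G where "G = {w. real (length w) ^ 3 * \<mu> w \<le> real l powr (- d * real (length w))}"
  have "\<exists>p\<ge>1. \<forall>u\<in>W n. (\<Sum>v | v \<in> W p \<and> u @ v \<in> G. \<mu> (u @ v)) \<ge> \<delta> / C * \<mu> u" for n
  proof -
    obtain p where p: "p \<ge> p0" "p \<ge> 1"
      "C * real l powr (d * real n) * (real n + real p) ^ 3 \<le> exp (sqrt (real p))"
      using exp_sqrt_beats_cube by blast
    have "(\<Sum>v | v \<in> W p \<and> u @ v \<in> G. \<mu> (u @ v)) \<ge> \<delta> / C * \<mu> u" if u: "u \<in> W n" for u
    proof (rule quasi_mass_step[OF u _ mass[OF p(1)]])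
      fix v assume v: "v \<in> W p" "v \<in> {v. exp (sqrt (real p)) * \<mu> v \<le> real l powr (- d * real p)}"
      have len: "length (u @ v) = n + p" using u v(1) by (simp add: level_words_def)
      have "(real n + real p) ^ 3 * \<mu> (u @ v) \<le> (real n + real p) ^ 3 * (C * (\<mu> u * \<mu> v))"
        using quasi_words(2)[OF u v(1)] by (intro mult_left_mono) auto
      also have "\<dots> \<le> (real n + real p) ^ 3 * (C * (1 * \<mu> v))"
        using C by (intro mult_left_mono mult_right_mono) auto
      also have "\<dots> = real l powr (- d * real n) *
          ((C * real l powr (d * real n) * (real n + real p) ^ 3) * \<mu> v)"
        using l by (simp add: powr_minus)
      also have "\<dots> \<le> real l powr (- d * real n) * (exp (sqrt (real p)) * \<mu> v)"
        using p(3) by (intro mult_right_mono mult_left_mono) auto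
      also have "\<dots> \<le> real l powr (- d * real n) * real l powr (- d * real p)"
        using v(2) by (intro mult_left_mono) auto
      also have "\<dots> = real l powr (- d * (real n + real p))"
        by (simp add: powr_add[symmetric] distrib_left)
      finally show "u @ v \<in> G" unfolding G_def using len by simp
    qed
    then show ?thesis using p(2) by blast
  qed
  then have "AE x in m. \<forall>n. \<exists>N\<ge>n. \<exists>w\<in>W N \<inter> G. x \<in> c w"
    using \<delta> C by (intro AE_infinitely_often_good[where \<delta> = "\<delta> / C"]) (auto simp: divide_le_eq)
  then show ?thesis
    by eventually_elim (fastforce simp: G_def level_words_def)
qed

end

section \<open>The partition function and the spectrum\<close>

text \<open>
  The value at \<open>n\<close> already determines the slope of an almost subadditive sequence from above:
  split off blocks of length \<open>n\<close>, each of which costs \<open>K\<close>.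
\<close>

lemma almost_subadditive_le:
  fixes a :: "nat \<Rightarrow> real"
  assumes n: "n \<ge> 1" and sub: "\<And>p. a (n + p) \<le> a n + a p + K"
  obtains B where "\<And>N. a N \<le> real N * ((a n + K) / real n) + B"
proof
  fix N
  define B where "B = (\<Sum>r<n. \<bar>a r\<bar>) + \<bar>a n + K\<bar>"
  show "a N \<le> real N * ((a n + K) / real n) + B"
  proof (induction N rule: less_induct)
    case (less N)
    show ?case
    proof (cases "N < n")
      case True
      have "\<bar>a N\<bar> \<le> (\<Sum>r<n. \<bar>a r\<bar>)"
        using True by (intro member_le_sum) auto
      moreover have "\<bar>real N * ((a n + K) / real n)\<bar> \<le> \<bar>a n + K\<bar>"
      proof -
        have "\<bar>real N * ((a n + K) / real n)\<bar> = (real N / real n) * \<bar>a n + K\<bar>"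
          by (simp add: abs_mult)
        also have "\<dots> \<le> 1 * \<bar>a n + K\<bar>"
          using True by (intro mult_right_mono) auto
        finally show ?thesis by simp
      qed
      ultimately show ?thesis unfolding B_def by linarith
    next
      case False
      then obtain p where p: "N = n + p" using le_Suc_ex not_less by blast
      then have "a N \<le> a n + a p + K" using sub by simp
      also have "\<dots> \<le> a n + (real p * ((a n + K) / real n) + B) + K"
        using less.IH[of p] p n by simp
      also have "\<dots> = real N * ((a n + K) / real n) + B"
        using n p by (simp add: field_simps)
      finally show ?thesis .
    qed
  qed
qed

text \<open>
  An almost additive sequence stays at bounded distance from a linear one, with the same constant for
  every \<open>n\<close>. Only because of this uniformity can the spectrum be evaluated at an argument \<open>1 - q\<close>
  where \<open>q\<close> itself varies with \<open>n\<close>.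
\<close>

lemma almost_additive_limsup:
  fixes a :: "nat \<Rightarrow> real"
  assumes add: "\<And>n p. \<bar>a (n + p) - a n - a p\<bar> \<le> K" and L: "L > 0" and n: "n \<ge> 1"
  shows "\<bar>a n - real n * L * real_of_ereal (limsup (\<lambda>N. ereal (1 / (real N * L) * a N)))\<bar> \<le> K"
proof -
  define \<Lambda> where "\<Lambda> = limsup (\<lambda>N. ereal (1 / (real N * L) * a N))"
  have sub: "a (n + p) \<le> a n + a p + K" "- a (n + p) \<le> - a n + - a p + K" for p
    using add[of n p] by linarith+
  obtain B where B: "\<And>N. a N \<le> real N * ((a n + K) / real n) + B"
    using almost_subadditive_le[OF n sub(1)] by blast
  obtain B' where B': "\<And>N. - a N \<le> real N * ((- a n + K) / real n) + B'"
    using almost_subadditive_le[OF n, of "\<lambda>N. - a N" K] sub(2) by blast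
  define y where "y = (a n + K) / real n / L"
  define x where "x = - ((- a n + K) / real n / L)"
  have scale: "1 / (real N * L) * (real N * z + b) = z / L + (b / L) * (1 / real N)"
    if "N \<ge> 1" for N z b
    using that L by (simp add: field_simps)
  have lim: "(\<lambda>N. z / L + (b / L) * (1 / real N)) \<longlonglongrightarrow> z / L" for z b
    by real_asymp
  have upper: "\<Lambda> \<le> ereal y"
  proof -
    have "eventually (\<lambda>N. ereal (1 / (real N * L) * a N) \<le> ereal (y + (B / L) * (1 / real N))) sequentially"
      using eventually_ge_at_top[of 1]
    proof eventually_elim
      case (elim N)
      have "1 / (real N * L) * a N \<le> 1 / (real N * L) * (real N * ((a n + K) / real n) + B)"
        using B[of N] L by (intro mult_left_mono) auto
      then show ?case unfolding scale[OF elim] y_def by simp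
    qed
    then have "\<Lambda> \<le> limsup (\<lambda>N. ereal (y + (B / L) * (1 / real N)))"
      unfolding \<Lambda>_def by (rule Limsup_mono)
    also have "\<dots> = ereal y"
      unfolding y_def by (intro lim_imp_Limsup tendsto_ereal lim) simp
    finally show ?thesis .
  qed
  have lower: "ereal x \<le> \<Lambda>"
  proof -
    have "eventually (\<lambda>N. ereal (x + (- B' / L) * (1 / real N)) \<le> ereal (1 / (real N * L) * a N)) sequentially"
      using eventually_ge_at_top[of 1]
    proof eventually_elim
      case (elim N)
      have "real N * (- ((- a n + K) / real n)) + - B' \<le> a N"
        using B'[of N] by simp
      then have "1 / (real N * L) * (real N * (- ((- a n + K) / real n)) + - B') \<le> 1 / (real N * L) * a N"
        using L by (intro mult_left_mono) auto
      then show ?case unfolding scale[OF elim] x_def by simp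
    qed
    then have "limsup (\<lambda>N. ereal (x + (- B' / L) * (1 / real N))) \<le> \<Lambda>"
      unfolding \<Lambda>_def by (rule Limsup_mono)
    moreover have "limsup (\<lambda>N. ereal (x + (- B' / L) * (1 / real N))) = ereal x"
    proof (intro lim_imp_Limsup tendsto_ereal)
      show "(\<lambda>N. x + (- B' / L) * (1 / real N)) \<longlonglongrightarrow> x"
        using lim[of "- ((- a n + K) / real n)" "- B'"] unfolding x_def minus_divide_left .
    qed simp
    ultimately show ?thesis by simp
  qed
  have "x \<le> real_of_ereal \<Lambda>" "real_of_ereal \<Lambda> \<le> y"
    using upper lower by (cases \<Lambda>; simp)+
  then have "real n * L * x \<le> real n * L * real_of_ereal \<Lambda>"
    "real n * L * real_of_ereal \<Lambda> \<le> real n * L * y"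
    using L by (auto intro!: mult_left_mono)
  moreover have "real n * L * x = a n - K" "real n * L * y = a n + K"
    using n L by (auto simp: x_def y_def field_simps)
  ultimately show ?thesis unfolding \<Lambda>_def by linarith
qed

text \<open>
  A Paley--Zygmund argument for the exponential \<open>exp (t * X)\<close>. The part of its mean that comes from
  \<open>X < 1\<close> is at most \<open>exp t\<close>, hence at most half of it; by Cauchy--Schwarz the rest cannot be carried
  by a set of small mass when the second moment is bounded.
\<close>

lemma second_moment_lower_bound:
  fixes \<nu> X :: "'a \<Rightarrow> real"
  assumes fin: "finite A" and nn: "\<And>w. w \<in> A \<Longrightarrow> \<nu> w \<ge> 0" and one: "(\<Sum>w\<in>A. \<nu> w) = 1"
    and t: "t > 0"
    and first: "(\<Sum>w\<in>A. \<nu> w * exp (t * X w)) \<ge> 2 * exp t"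
    and second: "(\<Sum>w\<in>A. \<nu> w * exp (2 * t * X w)) \<le> b" and b: "b > 0"
  shows "(\<Sum>w | w \<in> A \<and> X w \<ge> 1. \<nu> w) \<ge> exp (2 * t) / b"
proof -
  define A1 where "A1 = {w. w \<in> A \<and> X w \<ge> 1}"
  have A1: "A1 \<subseteq> A" "finite A1" using fin by (auto simp: A1_def)
  have "(\<Sum>w\<in>A - A1. \<nu> w * exp (t * X w)) \<le> (\<Sum>w\<in>A - A1. \<nu> w * exp t)"
    using nn t by (intro sum_mono mult_left_mono) (auto simp: A1_def)
  also have "\<dots> \<le> (\<Sum>w\<in>A. \<nu> w * exp t)"
    using fin nn by (intro sum_mono2) auto
  also have "\<dots> = exp t" using one by (simp flip: sum_distrib_right)
  finally have "exp t \<le> (\<Sum>w\<in>A1. \<nu> w * exp (t * X w))"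
    using first sum.subset_diff[OF A1(1) fin, of "\<lambda>w. \<nu> w * exp (t * X w)"] by simp
  then have "(exp t)\<^sup>2 \<le> (\<Sum>w\<in>A1. \<nu> w * exp (t * X w))\<^sup>2"
    by (intro power_mono) auto
  also have "\<dots> = (\<Sum>w\<in>A1. sqrt (\<nu> w) * (sqrt (\<nu> w) * exp (t * X w)))\<^sup>2"
    using nn A1 by (intro arg_cong[where f = "\<lambda>x. x\<^sup>2"] sum.cong) (auto simp flip: mult.assoc)
  also have "\<dots> \<le> (\<Sum>w\<in>A1. (sqrt (\<nu> w))\<^sup>2) * (\<Sum>w\<in>A1. (sqrt (\<nu> w) * exp (t * X w))\<^sup>2)"
    by (rule Cauchy_Schwarz_ineq_sum)
  also have "\<dots> = (\<Sum>w\<in>A1. \<nu> w) * (\<Sum>w\<in>A1. \<nu> w * exp (2 * t * X w))"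
    using nn A1 by (intro arg_cong2[where f = "(*)"] sum.cong)
      (auto simp: power_mult_distrib mult.assoc simp flip: exp_double)
  also have "\<dots> \<le> (\<Sum>w\<in>A1. \<nu> w) * b"
  proof (intro mult_left_mono sum_nonneg)
    have "(\<Sum>w\<in>A1. \<nu> w * exp (2 * t * X w)) \<le> (\<Sum>w\<in>A. \<nu> w * exp (2 * t * X w))"
      using fin nn A1 by (intro sum_mono2) auto
    then show "(\<Sum>w\<in>A1. \<nu> w * exp (2 * t * X w)) \<le> b" using second by simp
  qed (use nn A1 in auto)
  finally have "exp (2 * t) \<le> (\<Sum>w\<in>A1. \<nu> w) * b"
    by (simp add: exp_double)
  then show ?thesis using b by (simp add: A1_def divide_le_eq)
qed

context quasi_bernoulli_coding
begin

text \<open>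
  The partition function. The convention \<open>0 powr q = 0\<close> removes the cubes of mass zero from the sum.
\<close>

definition Z :: "real \<Rightarrow> nat \<Rightarrow> real" where
  "Z q n = (\<Sum>w\<in>W n. \<mu> w powr q)"

lemma Z_eq_sum_cubes:
  "(\<Sum>I \<in> {I \<in> adic_cubes l n. measure m I > 0}. measure m I powr q) = Z q n"
proof -
  have "finite (adic_cubes l n :: (real ^ 'd) set set)"
    using bij_c[of n] finite_level_words by (metis bij_betw_finite)
  then have "(\<Sum>I \<in> {I \<in> adic_cubes l n. measure m I > 0}. measure m I powr q) =
      (\<Sum>I \<in> adic_cubes l n. measure m I powr q)"
    by (intro sum.mono_neutral_left) (auto simp: zero_less_measure_iff)
  then show ?thesis
    unfolding Z_def sum.reindex_bij_betw[OF bij_c, symmetric, of "\<lambda>I. measure m I powr q"] .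
qed

lemma Z_pos: "Z q n > 0"
proof -
  have "\<exists>w\<in>W n. \<mu> w \<noteq> 0"
    using sum_cubes[of n] by (metis sum.neutral zero_neq_one)
  then show ?thesis
    unfolding Z_def using finite_level_words by (auto intro!: sum_pos2 simp: powr_gt_zero)
qed

lemma powr_quasi:
  assumes "y > 0" "y / C \<le> x" "x \<le> C * y"
  shows "x powr q \<le> C powr \<bar>q\<bar> * y powr q" "C powr (- \<bar>q\<bar>) * y powr q \<le> x powr q"
proof -
  have x: "x > 0" using assms C by (smt (verit) divide_pos_pos)
  have "ln (y / C) \<le> ln x" "ln x \<le> ln (C * y)"
    using assms C x by (auto intro!: ln_mono)
  moreover have "ln (y / C) = ln y - ln C" "ln (C * y) = ln C + ln y"
    using assms C by (auto simp: ln_div ln_mult_pos)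
  ultimately have "\<bar>ln x - ln y\<bar> \<le> ln C" by linarith
  then have "\<bar>q * (ln x - ln y)\<bar> \<le> \<bar>q\<bar> * ln C"
    unfolding abs_mult by (intro mult_left_mono) auto
  then have "q * ln x \<le> \<bar>q\<bar> * ln C + q * ln y" "- \<bar>q\<bar> * ln C + q * ln y \<le> q * ln x"
    by (simp_all add: right_diff_distrib abs_le_iff)
  then show "x powr q \<le> C powr \<bar>q\<bar> * y powr q" "C powr (- \<bar>q\<bar>) * y powr q \<le> x powr q"
    using x assms C by (simp_all add: powr_def flip: exp_add)
qed

lemma quasi_words_powr:
  assumes "u \<in> W n" "v \<in> W p"
  shows "\<mu> (u @ v) powr q \<le> C powr \<bar>q\<bar> * (\<mu> u powr q * \<mu> v powr q)"
    and "C powr (- \<bar>q\<bar>) * (\<mu> u powr q * \<mu> v powr q) \<le> \<mu> (u @ v) powr q"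
proof -
  have "\<mu> (u @ v) powr q \<le> C powr \<bar>q\<bar> * (\<mu> u powr q * \<mu> v powr q) \<and>
    C powr (- \<bar>q\<bar>) * (\<mu> u powr q * \<mu> v powr q) \<le> \<mu> (u @ v) powr q"
  proof (cases "\<mu> u * \<mu> v = 0")
    case True
    then have "\<mu> (u @ v) = 0"
      using quasi_words(2)[OF assms] measure_nonneg[of m "c (u @ v)"]
      by (metis mult_zero_right order_antisym)
    then show ?thesis using True by auto
  next
    case False
    then have "\<mu> u * \<mu> v > 0"
      using measure_nonneg[of m] by (metis mult_nonneg_nonneg less_eq_real_def)
    then show ?thesis
      using powr_quasi[OF _ quasi_words[OF assms], of q] by (simp add: powr_mult)
  qed
  then show "\<mu> (u @ v) powr q \<le> C powr \<bar>q\<bar> * (\<mu> u powr q * \<mu> v powr q)"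
    and "C powr (- \<bar>q\<bar>) * (\<mu> u powr q * \<mu> v powr q) \<le> \<mu> (u @ v) powr q" by auto
qed

lemma ln_Z_almost_additive: "\<bar>ln (Z q (n + p)) - ln (Z q n) - ln (Z q p)\<bar> \<le> \<bar>q\<bar> * ln C"
proof -
  have prod: "k * (Z q n * Z q p) = (\<Sum>u\<in>W n. \<Sum>v\<in>W p. k * (\<mu> u powr q * \<mu> v powr q))" for k
    unfolding Z_def sum_product by (simp add: sum_distrib_left)
  have "Z q (n + p) \<le> C powr \<bar>q\<bar> * (Z q n * Z q p)"
    unfolding prod unfolding Z_def sum_level_words_append
    by (intro sum_mono quasi_words_powr)
  then have "ln (Z q (n + p)) \<le> ln (C powr \<bar>q\<bar> * (Z q n * Z q p))"
    using Z_pos C by (intro ln_mono) auto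
  moreover have "C powr (- \<bar>q\<bar>) * (Z q n * Z q p) \<le> Z q (n + p)"
    unfolding prod unfolding Z_def sum_level_words_append
    by (intro sum_mono quasi_words_powr)
  then have "ln (C powr (- \<bar>q\<bar>) * (Z q n * Z q p)) \<le> ln (Z q (n + p))"
    using Z_pos C by (intro ln_mono) auto
  moreover have "ln (C powr s * (Z q n * Z q p)) = s * ln C + ln (Z q n) + ln (Z q p)" for s
    using Z_pos[of q n] Z_pos[of q p] C by (simp add: ln_mult_pos ln_powr)
  ultimately show ?thesis by (simp add: abs_le_iff)
qed

text \<open>
  By almost additivity the spectrum is more than a limit: it describes the partition function of
  every single generation, with an error that does not grow.
\<close>

lemma ln_Z_spectrum:
  assumes "n \<ge> 1"
  shows "\<bar>ln (Z q n) - real n * ln (real l) * Lq_spectrum l m q\<bar> \<le> \<bar>q\<bar> * ln C"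
  using almost_additive_limsup[of "\<lambda>n. ln (Z q n)", OF ln_Z_almost_additive ln_l assms]
  by (simp add: Lq_spectrum_def Z_eq_sum_cubes)

section \<open>Fluctuations of square root order\<close>

text \<open>
  The fluctuation of the information content \<open>- ln (\<mu> w)\<close> of a cube around the value that
  the dimension \<open>d\<close> predicts. Under \<open>m\<close> it plays the part of a centred random walk.
\<close>

definition S :: "real \<Rightarrow> nat \<Rightarrow> nat list \<Rightarrow> real" where
  "S d n w = - ln (\<mu> w) - real n * d * ln (real l)"

text \<open>
  The reason why the spectrum near \<open>1\<close> governs the law of the fluctuations: \<open>Z (1 - q) n\<close> is, up to
  normalisation, their moment generating function at \<open>q\<close>.
\<close>

lemma exponential_moment:
  "(\<Sum>w\<in>W n. \<mu> w * exp (q * S d n w)) = Z (1 - q) n * exp (- q * (real n * d * ln (real l)))"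
proof -
  have "\<mu> w * exp (q * S d n w) = \<mu> w powr (1 - q) * exp (- q * (real n * d * ln (real l)))" for w
  proof (cases "\<mu> w = 0")
    case False
    then have "\<mu> w > 0" by (simp add: zero_less_measure_iff)
    then have "\<mu> w powr (1 - q) = \<mu> w * exp (- q * ln (\<mu> w))"
      by (simp add: powr_def left_diff_distrib exp_diff exp_minus divide_inverse)
    then show ?thesis
      by (simp add: S_def right_diff_distrib flip: exp_add)
  qed simp
  then show ?thesis by (simp add: Z_def sum_distrib_right)
qed

lemma exponential_moment_bounds:
  assumes n: "n \<ge> 1" and q: "\<bar>q\<bar> \<le> 1"
    and \<epsilon>: "\<bar>Lq_spectrum l m (1 - q) - (q * d + \<sigma>\<^sup>2 / 2 * q\<^sup>2)\<bar> \<le> \<sigma>\<^sup>2 / 4 * q\<^sup>2"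
  shows "(\<Sum>w\<in>W n. \<mu> w * exp (q * S d n w)) \<ge> exp (real n * q\<^sup>2 * (ln (real l) * \<sigma>\<^sup>2 / 4) - 2 * ln C)"
    and "(\<Sum>w\<in>W n. \<mu> w * exp (q * S d n w)) \<le> exp (real n * q\<^sup>2 * (3 * ln (real l) * \<sigma>\<^sup>2 / 4) + 2 * ln C)"
proof -
  define \<tau> where "\<tau> = Lq_spectrum l m (1 - q)"
  define L where "L = ln (real l)"
  have L: "L > 0" unfolding L_def by (rule ln_l)
  define e where "e = ln (Z (1 - q) n) - q * (real n * d * L)"
  have eq: "(\<Sum>w\<in>W n. \<mu> w * exp (q * S d n w)) = exp e"
    unfolding exponential_moment e_def L_def using Z_pos[of "1 - q" n] by (simp add: exp_diff exp_minus divide_inverse)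
  \<comment> \<open>The multiplicative error \<open>C powr \<bar>1 - q\<bar>\<close> tends to \<open>C\<close>, not to one, as \<open>q\<close> tends to zero.\<close>
  have "\<bar>ln (Z (1 - q) n) - real n * L * \<tau>\<bar> \<le> \<bar>1 - q\<bar> * ln C"
    unfolding L_def \<tau>_def by (rule ln_Z_spectrum[OF n])
  also have "\<dots> \<le> 2 * ln C"
    using q C by (intro mult_right_mono) auto
  finally have 1: "\<bar>ln (Z (1 - q) n) - real n * L * \<tau>\<bar> \<le> 2 * ln C" .
  have "q\<^sup>2 * (\<sigma>\<^sup>2 / 4) \<le> \<tau> - q * d" "\<tau> - q * d \<le> q\<^sup>2 * (3 * \<sigma>\<^sup>2 / 4)"
    using \<epsilon> unfolding \<tau>_def[symmetric] abs_le_iff by (auto simp: algebra_simps)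
  then have "real n * L * (q\<^sup>2 * (\<sigma>\<^sup>2 / 4)) \<le> real n * L * (\<tau> - q * d)"
    "real n * L * (\<tau> - q * d) \<le> real n * L * (q\<^sup>2 * (3 * \<sigma>\<^sup>2 / 4))"
    using L by (intro mult_left_mono; simp)+
  moreover have "real n * L * (\<tau> - q * d) = real n * L * \<tau> - q * (real n * d * L)"
    by (simp add: algebra_simps)
  moreover have "real n * L * (q\<^sup>2 * (\<sigma>\<^sup>2 / 4)) = real n * q\<^sup>2 * (L * \<sigma>\<^sup>2 / 4)"
    "real n * L * (q\<^sup>2 * (3 * \<sigma>\<^sup>2 / 4)) = real n * q\<^sup>2 * (3 * L * \<sigma>\<^sup>2 / 4)"
    by simp_all
  ultimately have "real n * q\<^sup>2 * (L * \<sigma>\<^sup>2 / 4) - 2 * ln C \<le> e"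
    "e \<le> real n * q\<^sup>2 * (3 * L * \<sigma>\<^sup>2 / 4) + 2 * ln C"
    using 1 unfolding e_def by linarith+
  then show "(\<Sum>w\<in>W n. \<mu> w * exp (q * S d n w)) \<ge> exp (real n * q\<^sup>2 * (ln (real l) * \<sigma>\<^sup>2 / 4) - 2 * ln C)"
    and "(\<Sum>w\<in>W n. \<mu> w * exp (q * S d n w)) \<le> exp (real n * q\<^sup>2 * (3 * ln (real l) * \<sigma>\<^sup>2 / 4) + 2 * ln C)"
    unfolding eq L_def by simp_all
qed

text \<open>
  At \<open>q\<close> of order \<open>1 / sqrt p\<close> the quadratic term of the spectrum, multiplied by \<open>p\<close>, is of order one. So
  the exponential moments of \<open>S / sqrt p\<close> are those of a Gaussian variable up to bounded factors. These
  factors, which come from \<open>C\<close>, rule out a central limit theorem by this route, but at a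
  sufficiently large \<open>t\<close> the Gaussian growth beats them, and this suffices for a positive lower
  bound on both tails (the two signs of \<open>s\<close>).
\<close>

lemma deviation_lower_bound:
  assumes \<sigma>: "\<sigma> > 0"
    and exp: "(\<lambda>q. Lq_spectrum l m (1 - q) - (q * d + \<sigma>\<^sup>2 / 2 * q\<^sup>2)) \<in> o[at 0](\<lambda>q. q\<^sup>2)"
  obtains \<delta> p0 where "0 < \<delta>" "\<delta> \<le> 1"
    "\<And>p s. p \<ge> p0 \<Longrightarrow> \<bar>s\<bar> = 1 \<Longrightarrow> (\<Sum>w | w \<in> W p \<and> s * S d p w \<ge> sqrt (real p). \<mu> w) \<ge> \<delta>"
proof -
  have "eventually (\<lambda>q. norm (Lq_spectrum l m (1 - q) - (q * d + \<sigma>\<^sup>2 / 2 * q\<^sup>2)) \<le> \<sigma>\<^sup>2 / 4 * norm (q\<^sup>2)) (at 0)"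
    using landau_o.smallD[OF exp, of "\<sigma>\<^sup>2 / 4"] \<sigma> by simp
  then obtain \<rho> where \<rho>: "\<rho> > 0" and
    small: "\<And>q. q \<noteq> 0 \<Longrightarrow> \<bar>q\<bar> < \<rho> \<Longrightarrow>
      \<bar>Lq_spectrum l m (1 - q) - (q * d + \<sigma>\<^sup>2 / 2 * q\<^sup>2)\<bar> \<le> \<sigma>\<^sup>2 / 4 * q\<^sup>2"
    unfolding eventually_at by (auto simp: dist_norm)
  define r where "r = min \<rho> 1"
  have r: "r > 0" "r \<le> \<rho>" "r \<le> 1" using \<rho> by (auto simp: r_def)
  define L where "L = ln (real l)"
  have L: "L > 0" unfolding L_def by (rule ln_l)
  \<comment> \<open>\<open>t\<close> is so large that the lower bound for the moment at \<open>t\<close> exceeds \<open>2 * exp t\<close>.\<close>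
  define K where "K = 1 + 2 * ln C + ln 2"
  have K: "K \<ge> 1" unfolding K_def using C by simp
  define t where "t = max 1 (4 * K / (L * \<sigma>\<^sup>2))"
  have t: "t \<ge> 1" by (simp add: t_def)
  have tK: "t\<^sup>2 * (L * \<sigma>\<^sup>2 / 4) - 2 * ln C \<ge> t + ln 2"
  proof -
    have "4 * K / (L * \<sigma>\<^sup>2) \<le> t" by (simp add: t_def)
    then have "K \<le> t * (L * \<sigma>\<^sup>2 / 4)"
      using L \<sigma> by (simp add: pos_divide_le_eq field_simps)
    then have "t * K \<le> t * (t * (L * \<sigma>\<^sup>2 / 4))"
      using t by (intro mult_left_mono) auto
    moreover have "t * K \<ge> t + 2 * ln C + ln 2"
    proof -
      have "t * (2 * ln C + ln 2) \<ge> 1 * (2 * ln C + ln 2)"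
        using t C by (intro mult_right_mono) auto
      then show ?thesis by (simp add: K_def algebra_simps)
    qed
    ultimately show ?thesis by (simp add: power2_eq_square)
  qed
  define b where "b = exp (t\<^sup>2 * (3 * L * \<sigma>\<^sup>2) + 2 * ln C)"
  \<comment> \<open>The threshold for \<open>p\<close> brings both \<open>t / sqrt p\<close> and \<open>2 * t / sqrt p\<close> below \<open>r\<close>, where the expansion holds.\<close>
  have bound: "(\<Sum>w | w \<in> W p \<and> s * S d p w \<ge> sqrt (real p). \<mu> w) \<ge> exp (2 * t) / b"
    if p: "p \<ge> 1 + nat \<lceil>(2 * t / r)\<^sup>2\<rceil>" and s: "\<bar>s\<bar> = 1" for p s
  proof -
    have p_pos: "p \<ge> 1" "real p > 0" using p by auto
    have "(2 * t / r)\<^sup>2 < real p"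
      using p by linarith
    then have "2 * t / r < sqrt (real p)"
      by (rule real_less_rsqrt)
    then have "2 * t / sqrt (real p) < r"
      using p_pos r by (simp add: field_simps)
    moreover have "2 * t < sqrt (real p)"
    proof -
      have "2 * t \<le> 2 * t / r" using r t by (simp add: le_divide_eq)
      then show ?thesis using \<open>2 * t / r < sqrt (real p)\<close> by linarith
    qed
    moreover have "t / sqrt (real p) \<le> 2 * t / sqrt (real p)"
      using t by (intro divide_right_mono) auto
    moreover have "t / sqrt (real p) > 0"
      using t p_pos by auto
    ultimately have q: "\<bar>s * k * t / sqrt (real p)\<bar> < \<rho>" "\<bar>s * k * t / sqrt (real p)\<bar> \<le> 1"
        "s * k * t / sqrt (real p) \<noteq> 0" if "k \<in> {1, 2}" for k
      using that s t p_pos r by (auto simp: abs_mult)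
    have sq: "real p * (s * k * t / sqrt (real p))\<^sup>2 = k\<^sup>2 * t\<^sup>2" for k
      using s p_pos by (simp add: power_divide power_mult_distrib) (metis power2_abs one_power2)
    define X where "X w = s * S d p w / sqrt (real p)" for w
    have "exp (2 * t) / b \<le> (\<Sum>w | w \<in> W p \<and> X w \<ge> 1. \<mu> w)"
    proof (rule second_moment_lower_bound[OF finite_level_words measure_nonneg sum_cubes])
      have "2 * exp t = exp (t + ln 2)" by (simp add: exp_add)
      also have "\<dots> \<le> exp (t\<^sup>2 * (L * \<sigma>\<^sup>2 / 4) - 2 * ln C)" using tK by simp
      also have "\<dots> \<le> (\<Sum>w\<in>W p. \<mu> w * exp (s * 1 * t / sqrt (real p) * S d p w))"
        using exponential_moment_bounds(1)[OF p_pos(1) q(2) small[OF q(3,1)], of 1] sq[of 1]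
        by (simp add: L_def)
      also have "\<dots> = (\<Sum>w\<in>W p. \<mu> w * exp (t * X w))"
        by (simp add: X_def mult_ac)
      finally show "2 * exp t \<le> (\<Sum>w\<in>W p. \<mu> w * exp (t * X w))" .
      have "(\<Sum>w\<in>W p. \<mu> w * exp (2 * t * X w)) =
          (\<Sum>w\<in>W p. \<mu> w * exp (s * 2 * t / sqrt (real p) * S d p w))"
        by (simp add: X_def mult_ac)
      also have "\<dots> \<le> b"
        using exponential_moment_bounds(2)[OF p_pos(1) q(2) small[OF q(3,1)], of 2]
        unfolding sq b_def by (simp add: L_def mult.commute[of "t\<^sup>2"] mult.assoc)
      finally show "(\<Sum>w\<in>W p. \<mu> w * exp (2 * t * X w)) \<le> b" .
    qed (use t in \<open>auto simp: b_def\<close>)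
    moreover have "X w \<ge> 1 \<longleftrightarrow> s * S d p w \<ge> sqrt (real p)" for w
      using p_pos by (simp add: X_def le_divide_eq)
    ultimately show ?thesis by simp
  qed
  show ?thesis
  proof (rule that)
    show "0 < min 1 (exp (2 * t) / b)" by (simp add: b_def)
    show "min 1 (exp (2 * t) / b) \<le> 1" by simp
    show "(\<Sum>w | w \<in> W p \<and> s * S d p w \<ge> sqrt (real p). \<mu> w) \<ge> min 1 (exp (2 * t) / b)"
      if "p \<ge> 1 + nat \<lceil>(2 * t / r)\<^sup>2\<rceil>" "\<bar>s\<bar> = 1" for p s
      using bound[OF that] by simp
  qed
qed

text \<open>
  In the heavy case the restriction to words of positive mass matters, since \<open>ln 0 = 0\<close> makes
  \<open>S\<close> meaningless on the others; these contribute nothing to the sums.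
\<close>

lemma AE_heavy_and_light_cubes:
  assumes \<sigma>: "\<sigma> > 0"
    and exp: "(\<lambda>q. Lq_spectrum l m (1 - q) - (q * d + \<sigma>\<^sup>2 / 2 * q\<^sup>2)) \<in> o[at 0](\<lambda>q. q\<^sup>2)"
  shows "AE x in m. \<forall>n. \<exists>N\<ge>n. \<exists>w\<in>W N. \<mu> w \<ge> real N ^ 3 * real l powr (- d * real N) \<and> x \<in> c w"
    and "AE x in m. \<forall>n. \<exists>N\<ge>n. \<exists>w\<in>W N. real N ^ 3 * \<mu> w \<le> real l powr (- d * real N) \<and> x \<in> c w"
proof -
  obtain \<delta> p0 where \<delta>: "0 < \<delta>" "\<delta> \<le> 1" and
    dev: "\<And>p s. p \<ge> p0 \<Longrightarrow> \<bar>s\<bar> = 1 \<Longrightarrow> (\<Sum>w | w \<in> W p \<and> s * S d p w \<ge> sqrt (real p). \<mu> w) \<ge> \<delta>"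
    by (rule deviation_lower_bound[OF \<sigma> exp]) blast
  have mass: "(\<Sum>v\<in>W p \<inter> H. \<mu> v) \<ge> \<delta>"
    if p: "p \<ge> p0" and s: "\<bar>s\<bar> = 1"
      and H: "\<And>w. \<mu> w > 0 \<Longrightarrow> s * S d p w \<ge> sqrt (real p) \<Longrightarrow> w \<in> H" for p s H
  proof -
    have "\<delta> \<le> (\<Sum>w | w \<in> W p \<and> s * S d p w \<ge> sqrt (real p). \<mu> w)" by (rule dev[OF p s])
    also have "\<dots> = (\<Sum>w | w \<in> W p \<and> s * S d p w \<ge> sqrt (real p) \<and> \<mu> w > 0. \<mu> w)"
      using finite_level_words by (intro sum.mono_neutral_right) (auto simp: zero_less_measure_iff)
    also have "\<dots> \<le> (\<Sum>v\<in>W p \<inter> H. \<mu> v)"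
      using finite_level_words H by (intro sum_mono2) auto
    finally show ?thesis .
  qed
  show "AE x in m. \<forall>n. \<exists>N\<ge>n. \<exists>w\<in>W N. \<mu> w \<ge> real N ^ 3 * real l powr (- d * real N) \<and> x \<in> c w"
  proof (rule AE_infinitely_often_heavy_cube[OF mass[of _ "- 1"] \<delta>])
    fix p w assume w: "\<mu> w > 0" "- 1 * S d p w \<ge> sqrt (real p)"
    then have "sqrt (real p) + - d * real p * ln (real l) \<le> ln (\<mu> w)"
      by (simp add: S_def mult_ac)
    then have "exp (sqrt (real p) + - d * real p * ln (real l)) \<le> \<mu> w"
      using w(1) by (simp add: ln_ge_iff)
    then show "w \<in> {w. \<mu> w \<ge> exp (sqrt (real p)) * real l powr (- d * real p)}"
      using l by (simp add: powr_def exp_add[symmetric])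
  qed auto
  show "AE x in m. \<forall>n. \<exists>N\<ge>n. \<exists>w\<in>W N. real N ^ 3 * \<mu> w \<le> real l powr (- d * real N) \<and> x \<in> c w"
  proof (rule AE_infinitely_often_light_cube[OF mass[of _ 1] \<delta>])
    fix p w assume w: "\<mu> w > 0" "1 * S d p w \<ge> sqrt (real p)"
    then have "sqrt (real p) + ln (\<mu> w) \<le> - d * real p * ln (real l)"
      by (simp add: S_def mult_ac)
    then have "exp (sqrt (real p) + ln (\<mu> w)) \<le> exp (- d * real p * ln (real l))"
      by simp
    then show "w \<in> {w. exp (sqrt (real p)) * \<mu> w \<le> real l powr (- d * real p)}"
      using l w(1) by (simp add: powr_def exp_add)
  qed auto
qed

end

section \<open>A mass criterion for packing measures\<close>

text \<open>
  Subadditivity over a countable index set without a chosen enumeration, in the form in which sums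
  over packings are written.
\<close>

lemma measure_UN_le_infsum:
  fixes m :: "'b measure" and I :: "'a set" and f :: "'a \<Rightarrow> ennreal"
  assumes I: "countable I" and B: "\<And>i. i \<in> I \<Longrightarrow> B i \<in> sets m"
    and le: "\<And>i. i \<in> I \<Longrightarrow> emeasure m (B i) \<le> \<epsilon> * f i"
  shows "emeasure m (\<Union>i\<in>I. B i) \<le> \<epsilon> * infsum f I"
proof (cases "I = {}")
  case False
  define J where "J n = from_nat_into I ` {..n}" for n
  have J: "J n \<subseteq> I" "finite (J n)" for n
    using from_nat_into[OF False] by (auto simp: J_def)
  have "(\<Union>n. J n) = range (from_nat_into I)"
    by (force simp: J_def)
  also have "\<dots> = I"
    by (rule range_from_nat_into[OF False I])
  finally have "(\<Union>n. J n) = I" .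
  then have "emeasure m (\<Union>i\<in>I. B i) = emeasure m (\<Union>n. \<Union>i\<in>J n. B i)"
    by (intro arg_cong[where f = "emeasure m"]) blast
  also have "\<dots> = (SUP n. emeasure m (\<Union>i\<in>J n. B i))"
  proof (rule SUP_emeasure_incseq[symmetric])
    show "range (\<lambda>n. \<Union>i\<in>J n. B i) \<subseteq> sets m"
      using J B by (auto intro!: sets.finite_UN)
    show "incseq (\<lambda>n. \<Union>i\<in>J n. B i)"
      by (force simp: incseq_def J_def)
  qed
  also have "\<dots> \<le> \<epsilon> * infsum f I"
  proof (rule SUP_least)
    fix n
    have "emeasure m (\<Union>i\<in>J n. B i) \<le> (\<Sum>i\<in>J n. emeasure m (B i))"
      using J B by (intro emeasure_subadditive_finite) auto
    also have "\<dots> \<le> \<epsilon> * (\<Sum>i\<in>J n. f i)"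
      unfolding sum_distrib_left using J le by (intro sum_mono) auto
    also have "(\<Sum>i\<in>J n. f i) = infsum f (J n)"
      using J by simp
    also have "infsum f (J n) \<le> infsum f I"
      using J by (intro infsum_mono_neutral nonneg_summable_on_complete) auto
    finally show "emeasure m (\<Union>i\<in>J n. B i) \<le> \<epsilon> * infsum f I"
      by (simp add: mult_left_mono)
  qed
  finally show ?thesis .
qed simp

text \<open>
  Balls whose fivefold enlargement has small mass are turned into a packing by the Vitali covering
  lemma: the selected balls are disjoint, and the enlarged ones still cover \<open>A\<close>. So the mass of \<open>A\<close> is
  at most \<open>\<epsilon>\<close> times a packing sum. The set \<open>A\<close> is arbitrary, hence the measurable hull \<open>U\<close>.
\<close>

lemma packing_cover_measure_le:
  fixes m :: "'a::euclidean_space measure"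
  assumes sets_m: "sets m = sets borel" and \<eta>: "\<eta> > 0"
    and small: "\<And>x. x \<in> A \<Longrightarrow> \<exists>r>0. 2 * r \<le> \<eta> \<and>
        emeasure m (cball x (5 * r)) \<le> \<epsilon> * ennreal ((2 * r) powr s)"
  obtains U where "U \<in> sets m" "A \<subseteq> U"
    "emeasure m U \<le> \<epsilon> * (SUP \<B> \<in> packings \<eta> A. \<Sum>\<^sub>\<infinity>B \<in> \<B>. ennreal (diameter B powr s))"
proof -
  obtain r where r: "\<And>x. x \<in> A \<Longrightarrow> r x > 0" "\<And>x. x \<in> A \<Longrightarrow> 2 * r x \<le> \<eta>"
    "\<And>x. x \<in> A \<Longrightarrow> emeasure m (cball x (5 * r x)) \<le> \<epsilon> * ennreal ((2 * r x) powr s)"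
    using small by metis
  have r': "0 < r x \<and> r x \<le> \<eta> / 2" if "x \<in> A" for x
    using r(1,2)[OF that] by linarith
  have "A \<subseteq> (\<Union>x\<in>A. cball x (r x))"
    using r(1) by (force intro: less_imp_le)
  then obtain I where I: "countable I" "I \<subseteq> A"
    "pairwise (\<lambda>x y. disjnt (cball x (r x)) (cball y (r y))) I"
    "A \<subseteq> (\<Union>x\<in>I. cball x (5 * r x))"
    by (rule Vitali_covering_lemma_cballs[where K = A and r = r and a = "\<lambda>x. x" and B = "\<eta> / 2"])
      (use r' in auto)
  define ball where "ball x = cball x (r x)" for x
  have diam: "diameter (ball x) = 2 * r x" if "x \<in> I" for x
    using r(1)[of x] I(2) that by (auto simp: ball_def subset_iff)
  have "inj_on ball I"
  proof (rule inj_onI)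
    fix x y assume xy: "x \<in> I" "y \<in> I" "ball x = ball y"
    show "x = y"
    proof (rule ccontr)
      assume "x \<noteq> y"
      then have "disjnt (ball x) (ball y)"
        using I(3) xy(1,2) by (simp add: pairwise_def ball_def)
      moreover have "x \<in> ball x"
        using r'[of x] I(2) xy(1) by (auto simp: ball_def subset_iff)
      ultimately show False using xy(3) by (auto simp: disjnt_def)
    qed
  qed
  have "ball ` I \<in> packings \<eta> A"
    unfolding packings_def
  proof (intro CollectI conjI ballI)
    show "countable (ball ` I)" using I(1) by simp
    show "disjoint (ball ` I)"
      using I(3) by (intro pairwise_imageI) (auto simp: pairwise_def ball_def)
    fix B assume "B \<in> ball ` I"
    then obtain x where x: "x \<in> I" "B = ball x" by blast
    then show "\<exists>x\<in>A. \<exists>r. B = cball x r" using I(2) by (auto simp: ball_def)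
    show "0 < diameter B" "diameter B \<le> \<eta>"
      using x diam r(1,2) I(2) by auto
  qed
  then have pack: "(\<Sum>\<^sub>\<infinity>B \<in> ball ` I. ennreal (diameter B powr s)) \<le>
      (SUP \<B> \<in> packings \<eta> A. \<Sum>\<^sub>\<infinity>B \<in> \<B>. ennreal (diameter B powr s))"
    by (rule SUP_upper)
  define U where "U = (\<Union>x\<in>I. cball x (5 * r x))"
  have "emeasure m U \<le> \<epsilon> * (\<Sum>\<^sub>\<infinity>x\<in>I. ennreal ((2 * r x) powr s))"
    unfolding U_def using I(1,2) r(3) sets_m by (intro measure_UN_le_infsum) auto
  also have "(\<Sum>\<^sub>\<infinity>x\<in>I. ennreal ((2 * r x) powr s)) = (\<Sum>\<^sub>\<infinity>B \<in> ball ` I. ennreal (diameter B powr s))"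
    unfolding infsum_reindex[OF \<open>inj_on ball I\<close>] using diam by (intro infsum_cong) simp
  also have "\<epsilon> * \<dots> \<le> \<epsilon> * (SUP \<B> \<in> packings \<eta> A. \<Sum>\<^sub>\<infinity>B \<in> \<B>. ennreal (diameter B powr s))"
    by (intro mult_left_mono pack) simp
  finally have "emeasure m U \<le> \<epsilon> * (SUP \<B> \<in> packings \<eta> A. \<Sum>\<^sub>\<infinity>B \<in> \<B>. ennreal (diameter B powr s))" .
  moreover have "U \<in> sets m"
    unfolding U_def sets_m using I(1) by (intro sets.countable_UN') auto
  moreover have "A \<subseteq> U" using I(4) by (simp add: U_def)
  ultimately show ?thesis using that by blast
qed

lemma packings_mono: "A \<subseteq> B \<Longrightarrow> packings \<eta> A \<subseteq> packings \<eta> B"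
  unfolding packings_def by blast

text \<open>
  A fixed \<open>\<eta>\<close> bounds all packing sums by one finite number, so letting \<open>\<epsilon>\<close> tend to zero gives measurable
  hulls of arbitrarily small mass.
\<close>

lemma null_of_finite_packing_premeasure:
  fixes m :: "'a::euclidean_space measure"
  assumes sets_m: "sets m = sets borel"
    and small: "\<And>x \<epsilon> \<eta>. x \<in> A \<Longrightarrow> \<epsilon> > 0 \<Longrightarrow> \<eta> > 0 \<Longrightarrow> \<exists>r>0. 2 * r \<le> \<eta> \<and>
        emeasure m (cball x (5 * r)) \<le> ennreal \<epsilon> * ennreal ((2 * r) powr s)"
    and finite: "packing_premeasure s A < \<infinity>"
  shows "\<exists>N\<in>null_sets m. A \<subseteq> N"
proof -
  obtain \<eta> where \<eta>: "\<eta> > 0" and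
    P: "(SUP \<B> \<in> packings \<eta> A. \<Sum>\<^sub>\<infinity>B \<in> \<B>. ennreal (diameter B powr s)) < \<infinity>"
    using finite unfolding packing_premeasure_def INF_less_iff by blast
  define P where "P = (SUP \<B> \<in> packings \<eta> A. \<Sum>\<^sub>\<infinity>B \<in> \<B>. ennreal (diameter B powr s))"
  have "\<exists>U. U \<in> sets m \<and> A \<subseteq> U \<and> emeasure m U \<le> ennreal (1 / real (Suc k)) * P" for k
  proof -
    have "1 / real (Suc k) > 0" by simp
    from packing_cover_measure_le[OF sets_m \<eta> small[OF _ this \<eta>]]
    show ?thesis unfolding P_def by blast
  qed
  then obtain U where U: "\<And>k. U k \<in> sets m" "\<And>k. A \<subseteq> U k"
    "\<And>k. emeasure m (U k) \<le> ennreal (1 / real (Suc k)) * P"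
    by metis
  have "emeasure m (\<Inter>k. U k) \<le> 0"
  proof (rule tendsto_lowerbound)
    obtain p where p: "P = ennreal p" "p \<ge> 0"
      using P unfolding P_def[symmetric] by (cases P) auto
    have "(\<lambda>k. 1 / real (Suc k) * p) \<longlonglongrightarrow> 0" by real_asymp
    then have "(\<lambda>k. ennreal (1 / real (Suc k) * p)) \<longlonglongrightarrow> ennreal 0"
      by (rule tendsto_ennrealI)
    then show "(\<lambda>k. ennreal (1 / real (Suc k)) * P) \<longlonglongrightarrow> 0"
      unfolding p(1) using p(2) by (simp add: ennreal_mult[symmetric] del: of_nat_Suc)
    show "eventually (\<lambda>k. emeasure m (\<Inter>k. U k) \<le> ennreal (1 / real (Suc k)) * P) sequentially"
    proof (rule always_eventually, rule allI)
      fix k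
      have "emeasure m (\<Inter>k. U k) \<le> emeasure m (U k)"
        using U(1) by (intro emeasure_mono) auto
      then show "emeasure m (\<Inter>k. U k) \<le> ennreal (1 / real (Suc k)) * P"
        using U(3)[of k] by simp
    qed
  qed simp
  then have "(\<Inter>k. U k) \<in> null_sets m"
    using U(1) by (intro null_setsI) auto
  then show ?thesis using U(2) by blast
qed

lemma null_of_finite_packing_measure:
  fixes m :: "'a::euclidean_space measure"
  assumes sets_m: "sets m = sets borel"
    and small: "AE x in m. \<forall>\<epsilon>>0. \<forall>\<eta>>0. \<exists>r>0. 2 * r \<le> \<eta> \<and>
        emeasure m (cball x (5 * r)) \<le> ennreal \<epsilon> * ennreal ((2 * r) powr s)"
    and E: "E \<in> sets m" and finite: "packing_measure s E < \<infinity>"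
  shows "E \<in> null_sets m"
proof -
  define thin where "thin x \<longleftrightarrow> (\<forall>\<epsilon>>0. \<forall>\<eta>>0. \<exists>r>0. 2 * r \<le> \<eta> \<and>
      emeasure m (cball x (5 * r)) \<le> ennreal \<epsilon> * ennreal ((2 * r) powr s))" for x
  obtain N0 where N0: "\<And>x. x \<in> space m - N0 \<Longrightarrow> thin x" "N0 \<in> null_sets m"
    by (rule AE_E3[OF small[folded thin_def]]) blast
  obtain A where A: "E \<subseteq> (\<Union>i::nat. A i)" "(\<Sum>i. packing_premeasure s (A i)) < \<infinity>"
    using finite unfolding packing_measure_def INF_less_iff by blast
  have "\<exists>N\<in>null_sets m. A i - N0 \<subseteq> N" for i
  proof (rule null_of_finite_packing_premeasure[OF sets_m])
    have "packing_premeasure s (A i - N0) \<le> packing_premeasure s (A i)"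
      unfolding packing_premeasure_def by (intro INF_mono' SUP_subset_mono packings_mono) auto
    also have "\<dots> < \<infinity>"
      using A(2) ennreal_suminf_lessD by blast
    finally show "packing_premeasure s (A i - N0) < \<infinity>" .
    show "\<exists>r>0. 2 * r \<le> \<eta> \<and> emeasure m (cball x (5 * r)) \<le> ennreal \<epsilon> * ennreal ((2 * r) powr s)"
      if "x \<in> A i - N0" "\<epsilon> > 0" "\<eta> > 0" for x \<epsilon> \<eta>
      using that N0(1)[of x] sets_eq_imp_space_eq[OF sets_m] by (auto simp: thin_def)
  qed
  then obtain N where N: "\<And>i. N i \<in> null_sets m" "\<And>i. A i - N0 \<subseteq> N i" by metis
  have "N0 \<union> (\<Union>i. N i) \<in> null_sets m"
    using N0(2) N(1) by (intro null_sets.Un null_sets_UN)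
  then show ?thesis
  proof (rule null_sets_subset[OF _ E])
    show "E \<subseteq> N0 \<union> (\<Union>i. N i)" using A(1) N(2) by blast
  qed
qed

context quasi_bernoulli_coding
begin

section \<open>Balls and cubes\<close>

text \<open>
  A ball of radius \<open>1 / l ^ n\<close> around a point of a cube is covered by the cube and its neighbours, and
  nothing prevents a single neighbour from being much heavier. But this is rare: summed over all cubes,
  the masses of the neighbourhoods amount to a bounded multiple of the total mass, because a point
  lies in boundedly many neighbourhoods. So the cubes whose neighbourhood is heavier by the factor
  \<open>n\<^sup>2\<close> have total mass of order \<open>1 / n\<^sup>2\<close>, which is summable. Arguments
  with points deep inside their cubes would fail, since \<open>m\<close> may be carried by the faces of cubes.
\<close>

lemma AE_neighbourhood_comparable:
  "AE x in m. eventually (\<lambda>n. \<forall>w\<in>W n. x \<in> c w \<longrightarrow>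
      measure m (cball x (1 / real l ^ n)) \<le> real n ^ 2 * \<mu> w) sequentially"
proof -
  define cube where "cube n k = cell l n -` {k}" for n and k :: "'d \<Rightarrow> int"
  have sets_cell: "cube n k \<in> sets m" for n k
    using measurable_cell sets_m unfolding cube_def by blast
  define shifts :: "('d \<Rightarrow> int) set" where "shifts = (UNIV \<rightarrow>\<^sub>E {-1, 0, 1})"
  have fin: "finite shifts" unfolding shifts_def by (intro finite_PiE) auto
  define idx where "idx n w = (SOME k. c w = cube n k)" for n w
  have idx: "c w = cube n (idx n w)" if w: "w \<in> W n" for n w
  proof -
    obtain k where "c w = cell l n -` {k}" using cube_eq_vimage[OF w] .
    then have "c w = cube n k" by (simp add: cube_def)
    then show ?thesis unfolding idx_def by (rule someI[of "\<lambda>k. c w = cube n k"])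
  qed
  define nbr where "nbr n w = (\<Union>s\<in>shifts. cube n (\<lambda>i. idx n w i + s i))" for n w
  have cball_nbr: "cball x (1 / real l ^ n) \<subseteq> nbr n w" if "w \<in> W n" "x \<in> c w" for n w x
  proof
    fix y assume y: "y \<in> cball x (1 / real l ^ n)"
    have x: "cell l n x = idx n w" using that idx by (auto simp: cube_def)
    define s where "s i = cell l n y i - cell l n x i" for i
    have "\<bar>s i\<bar> \<le> 1" for i
      unfolding s_def using l y by (intro cell_cball) auto
    then have "s i \<in> {-1, 0, 1}" for i
      by (smt (verit) insert_iff)
    then have "s \<in> shifts" unfolding shifts_def by auto
    moreover have "y \<in> cube n (\<lambda>i. idx n w i + s i)"
      unfolding cube_def by (auto simp: s_def x fun_eq_iff)
    ultimately show "y \<in> nbr n w" unfolding nbr_def by blast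
  qed
  have sets_nbr: "nbr n w \<in> sets m" for n w
    unfolding nbr_def using fin sets_cell by (intro sets.finite_UN) auto
  have sum_nbr: "(\<Sum>w\<in>W n. measure m (nbr n w)) \<le> real (card shifts)" for n
  proof -
    have "(\<Sum>w\<in>W n. measure m (nbr n w)) \<le> (\<Sum>w\<in>W n. \<Sum>s\<in>shifts. measure m (cube n (\<lambda>i. idx n w i + s i)))"
      unfolding nbr_def using fin sets_cell
      by (intro sum_mono finite_measure_subadditive_finite) auto
    also have "\<dots> = (\<Sum>s\<in>shifts. \<Sum>w\<in>W n. measure m (cube n (\<lambda>i. idx n w i + s i)))"
      by (rule sum.swap)
    also have "\<dots> \<le> (\<Sum>s\<in>shifts. 1)"
    proof (rule sum_mono)
      fix s :: "'d \<Rightarrow> int"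
      have "disjoint_family_on (\<lambda>w. cube n (\<lambda>i. idx n w i + s i)) (W n)"
        unfolding disjoint_family_on_def
      proof (intro ballI impI)
        fix w w' assume w: "w \<in> W n" "w' \<in> W n" "w \<noteq> w'"
        have "idx n w \<noteq> idx n w'"
          using w idx bij_c[of n] by (metis bij_betw_imp_inj_on inj_onD)
        then show "cube n (\<lambda>i. idx n w i + s i) \<inter> cube n (\<lambda>i. idx n w' i + s i) = {}"
          by (auto simp: cube_def fun_eq_iff)
      qed
      then have "(\<Sum>w\<in>W n. measure m (cube n (\<lambda>i. idx n w i + s i))) =
          measure m (\<Union>w\<in>W n. cube n (\<lambda>i. idx n w i + s i))"
        using sets_cell finite_level_words by (intro measure_finite_Union[symmetric]) auto
      also have "\<dots> \<le> 1" by simp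
      finally show "(\<Sum>w\<in>W n. measure m (cube n (\<lambda>i. idx n w i + s i))) \<le> 1" .
    qed
    finally show ?thesis by simp
  qed
  define bad where "bad n = {w \<in> W n. measure m (nbr n w) > real n ^ 2 * \<mu> w}" for n
  define Bad where "Bad n = (\<Union>w\<in>bad n. c w)" for n
  have bad: "bad n \<subseteq> W n" "finite (bad n)" for n
    using finite_level_words by (auto simp: bad_def)
  have sets_bad: "c w \<in> sets m" if "w \<in> bad n" for n w
    using bad(1)[of n] that by (intro sets_cube) auto
  then have sets_Bad: "Bad n \<in> sets m" for n
    unfolding Bad_def by (intro sets.finite_UN bad(2))
  have measure_Bad: "measure m (Bad n) \<le> real (card shifts) * (1 / real n ^ 2)" if n: "n \<ge> 1" for n
  proof -
    have "real n ^ 2 * measure m (Bad n) \<le> real n ^ 2 * (\<Sum>w\<in>bad n. \<mu> w)"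
      unfolding Bad_def using sets_bad
      by (intro mult_left_mono finite_measure_subadditive_finite bad(2)) auto
    also have "\<dots> \<le> (\<Sum>w\<in>bad n. measure m (nbr n w))"
      unfolding sum_distrib_left by (intro sum_mono) (auto simp: bad_def)
    also have "\<dots> \<le> (\<Sum>w\<in>W n. measure m (nbr n w))"
      using bad finite_level_words by (intro sum_mono2) auto
    also have "\<dots> \<le> real (card shifts)" by (rule sum_nbr)
    finally show ?thesis using n by (simp add: field_simps)
  qed
  have "summable (\<lambda>n. measure m (Bad n))"
  proof (rule summable_comparison_test_ev)
    show "eventually (\<lambda>n. norm (measure m (Bad n)) \<le> real (card shifts) * (1 / real n ^ 2)) sequentially"
      using eventually_ge_at_top[of 1] by eventually_elim (use measure_Bad in simp)
    show "summable (\<lambda>n. real (card shifts) * (1 / real n ^ 2))"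
      using inverse_power_summable[of 2, where 'a = real]
      by (intro summable_mult) (simp add: divide_inverse)
  qed
  then have "AE x in m. eventually (\<lambda>n. x \<in> space m - Bad n) sequentially"
    using sets_Bad by (intro borel_cantelli_AE1) (auto simp: emeasure_eq_measure)
  then show ?thesis
  proof eventually_elim
    case (elim x)
    then show ?case
    proof eventually_elim
      case (elim n)
      show ?case
      proof (intro ballI impI)
        fix w assume w: "w \<in> W n" "x \<in> c w"
        have "measure m (cball x (1 / real l ^ n)) \<le> measure m (nbr n w)"
          using cball_nbr[OF w] sets_nbr by (intro finite_measure_mono)
        also have "\<dots> \<le> real n ^ 2 * \<mu> w"
          using elim w by (auto simp: Bad_def bad_def not_less)
        finally show "measure m (cball x (1 / real l ^ n)) \<le> real n ^ 2 * \<mu> w" .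
      qed
    qed
  qed
qed

lemma powr_level: "real l powr (- d * real n) = (1 / real l ^ n) powr d"
proof -
  have "1 / real l ^ n = real l powr (- real n)"
    using l by (simp add: powr_minus powr_realpow divide_inverse)
  then show ?thesis by (simp add: powr_powr mult.commute)
qed

text \<open>
  In a light cube of generation \<open>n\<close> the mass is below \<open>l powr (- d * n)\<close> by the factor \<open>n ^ 3\<close>; passing to the
  ball gives back \<open>n\<^sup>2\<close>, and the last factor \<open>n\<close> makes the ratio arbitrarily small.
\<close>

lemma AE_small_balls:
  assumes light: "AE x in m. \<forall>n. \<exists>N\<ge>n. \<exists>w\<in>W N. real N ^ 3 * \<mu> w \<le> real l powr (- d * real N) \<and> x \<in> c w"
  shows "AE x in m. \<forall>\<epsilon>>0. \<forall>\<eta>>0. \<exists>r>0. 2 * r \<le> \<eta> \<and>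
        emeasure m (cball x (5 * r)) \<le> ennreal \<epsilon> * ennreal ((2 * r) powr d)"
  using light AE_neighbourhood_comparable
proof eventually_elim
  case (elim x)
  obtain n0 where n0: "\<And>n w. n \<ge> n0 \<Longrightarrow> w \<in> W n \<Longrightarrow> x \<in> c w \<Longrightarrow>
      measure m (cball x (1 / real l ^ n)) \<le> real n ^ 2 * \<mu> w"
    using elim(2) unfolding eventually_sequentially by blast
  show ?case
  proof (intro allI impI)
    fix \<epsilon> \<eta> :: real assume \<epsilon>: "\<epsilon> > 0" and \<eta>: "\<eta> > 0"
    have "(\<lambda>n. (1 / real l) ^ n) \<longlonglongrightarrow> 0"
      using l by (intro LIMSEQ_power_zero) auto
    then have "eventually (\<lambda>n. (1 / real l) ^ n < \<eta>) sequentially"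
      using \<eta> by (rule order_tendstoD(2))
    then obtain n1 where n1: "\<And>n. n \<ge> n1 \<Longrightarrow> 1 / real l ^ n < \<eta>"
      unfolding eventually_sequentially by (auto simp: power_one_over)
    define n2 where "n2 = max 1 (max n0 (max n1 (nat \<lceil>(5 / 2) powr d / \<epsilon>\<rceil>)))"
    obtain n w where n: "n \<ge> n2" and w: "w \<in> W n" "real n ^ 3 * \<mu> w \<le> real l powr (- d * real n)" "x \<in> c w"
      using elim(1) by blast
    have n': "n \<ge> 1" "n \<ge> n0" "n \<ge> n1" using n unfolding n2_def by auto
    have "nat \<lceil>(5 / 2) powr d / \<epsilon>\<rceil> \<le> n" using n unfolding n2_def by auto
    then have "(5 / 2) powr d / \<epsilon> \<le> real n" by linarith
    then have n\<epsilon>: "(5 / 2) powr d \<le> real n * \<epsilon>" using \<epsilon> by (simp add: pos_divide_le_eq)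
    \<comment> \<open>The enlarged ball of radius \<open>5 * r\<close> is the one that is compared with the cube.\<close>
    define r where "r = 1 / real l ^ n / 5"
    have r: "r > 0" unfolding r_def using l by simp
    have "2 * r \<le> \<eta>" using n1[OF n'(3)] l unfolding r_def by (simp add: field_simps)
    have "real n * measure m (cball x (5 * r)) \<le> real n * (real n ^ 2 * \<mu> w)"
      unfolding r_def using n0[OF n'(2) w(1,3)] by (intro mult_left_mono) auto
    also have "\<dots> = real n ^ 3 * \<mu> w" by (simp add: power2_eq_square power3_eq_cube)
    also have "\<dots> \<le> (1 / real l ^ n) powr d" using w(2) unfolding powr_level .
    also have "1 / real l ^ n = 5 / 2 * (2 * r)" unfolding r_def by simp
    also have "(5 / 2 * (2 * r)) powr d = (5 / 2) powr d * (2 * r) powr d"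
      using r by (subst powr_mult) auto
    also have "\<dots> \<le> real n * \<epsilon> * (2 * r) powr d"
      using n\<epsilon> by (intro mult_right_mono) auto
    finally have "measure m (cball x (5 * r)) \<le> \<epsilon> * (2 * r) powr d"
      using n'(1) by (simp add: mult.assoc)
    then have "emeasure m (cball x (5 * r)) \<le> ennreal \<epsilon> * ennreal ((2 * r) powr d)"
      using \<epsilon> by (simp add: emeasure_eq_measure flip: ennreal_mult)
    then show "\<exists>r>0. 2 * r \<le> \<eta> \<and> emeasure m (cball x (5 * r)) \<le> ennreal \<epsilon> * ennreal ((2 * r) powr d)"
      using r \<open>2 * r \<le> \<eta>\<close> by blast
  qed
qed


section \<open>Hausdorff measure of a set of full mass\<close>

text \<open>
  For a heavy cube the Hausdorff gauge is a small multiple of the mass; summed over disjoint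
  heavy cubes it is therefore small.
\<close>

lemma hausdorff_gauge_cube_le:
  assumes w: "w \<in> W N" and d: "d > 0" and N: "N \<ge> n" "n \<ge> 1"
    and heavy: "\<mu> w \<ge> real N ^ 3 * real l powr (- d * real N)"
  shows "hausdorff_gauge d (c w) \<le> ennreal (real CARD('d) powr d / real n) * emeasure m (c w)"
proof -
  obtain k where k: "c w = adic_cube l N k" using cube_of_word[OF w] .
  have diam: "0 \<le> diameter (c w)" "diameter (c w) \<le> real CARD('d) / real l ^ N"
    unfolding k using diameter_adic_cube[of l N k] l by (auto intro: diameter_ge_0)
  have "diameter (c w) powr d \<le> (real CARD('d) * (1 / real l ^ N)) powr d"
    using diam d by (intro powr_mono2) auto
  also have "\<dots> = real CARD('d) powr d * real l powr (- d * real N)"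
    unfolding powr_level by (subst powr_mult) auto
  also have "\<dots> \<le> real CARD('d) powr d * (\<mu> w / real n)"
  proof (intro mult_left_mono)
    have "real n * 1 \<le> real N * real N ^ 2"
      using N by (intro mult_mono) auto
    then have "real n * real l powr (- d * real N) \<le> real N ^ 3 * real l powr (- d * real N)"
      by (intro mult_right_mono) (auto simp: power3_eq_cube power2_eq_square mult.assoc)
    then show "real l powr (- d * real N) \<le> \<mu> w / real n"
      using heavy N by (simp add: field_simps)
  qed auto
  finally have "diameter (c w) powr d \<le> real CARD('d) powr d / real n * \<mu> w" by simp
  then have "ennreal (diameter (c w) powr d) \<le> ennreal (real CARD('d) powr d / real n) * emeasure m (c w)"
    by (simp add: emeasure_eq_measure ennreal_leI flip: ennreal_mult)
  then show ?thesis using d by (simp add: hausdorff_gauge_def)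
qed

definition heavy_words :: "real \<Rightarrow> nat \<Rightarrow> nat list set" where
  "heavy_words d n = {w. length w \<ge> n \<and> w \<in> W (length w) \<and>
      \<mu> w \<ge> real (length w) ^ 3 * real l powr (- d * real (length w))}"

text \<open>
  Stopping at the first heavy prefix makes the cubes disjoint without changing their union.
\<close>

definition first_heavy_words :: "real \<Rightarrow> nat \<Rightarrow> nat list set" where
  "first_heavy_words d n = {w \<in> heavy_words d n. \<forall>k<length w. take k w \<notin> heavy_words d n}"

lemma take_in_W: "w \<in> W N \<Longrightarrow> k \<le> N \<Longrightarrow> take k w \<in> W k"
  by (auto simp: level_words_def words_def dest: in_set_takeD)

lemma cube_subset_cube_take:
  assumes "w \<in> W N"
  shows "c w \<subseteq> c (take k w)"
proof -
  have "take k w \<in> words a" "drop k w \<in> words a"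
    using assms by (auto simp: level_words_def words_def dest: in_set_takeD in_set_dropD)
  from cube_append_subset[OF this] show ?thesis by simp
qed

lemma first_heavy_words_unique:
  assumes "w \<in> first_heavy_words d n" "w' \<in> first_heavy_words d n" "x \<in> c w" "x \<in> c w'"
    and le: "length w \<le> length w'"
  shows "w = w'"
proof -
  have W: "w \<in> W (length w)" "w' \<in> W (length w')"
    using assms(1,2) by (auto simp: first_heavy_words_def heavy_words_def)
  have "x \<in> c (take (length w) w')"
    using cube_subset_cube_take[OF W(2)] assms(4) by blast
  then have eq: "w = take (length w) w'"
    using cubes_disjoint[OF W(1) take_in_W[OF W(2) le] assms(3)] by simp
  have "\<not> length w < length w'"
    using assms(1,2) eq unfolding first_heavy_words_def by (metis (mono_tags, lifting) mem_Collect_eq)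
  then show ?thesis using eq le by simp
qed

lemma first_heavy_words_cover:
  assumes "w \<in> heavy_words d n" "x \<in> c w"
  obtains w' where "w' \<in> first_heavy_words d n" "x \<in> c w'"
proof -
  define k where "k = (LEAST k. take k w \<in> heavy_words d n)"
  have "take (length w) w \<in> heavy_words d n" using assms(1) by simp
  then have k: "take k w \<in> heavy_words d n" unfolding k_def by (rule LeastI)
  have "take j (take k w) \<notin> heavy_words d n" if "j < length (take k w)" for j
  proof -
    have "j < k" using that by simp
    then have "take j w \<notin> heavy_words d n"
      unfolding k_def by (rule not_less_Least)
    then show ?thesis using \<open>j < k\<close> by (simp add: min_def)
  qed
  then have "take k w \<in> first_heavy_words d n"
    using k by (simp add: first_heavy_words_def)
  moreover have "x \<in> c (take k w)"
    using cube_subset_cube_take[of w "length w" k] assms by (auto simp: heavy_words_def)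
  ultimately show ?thesis by (rule that)
qed

text \<open>
  The disjoint heavy cubes from generation \<open>n\<close> on cover \<open>E\<close> with a gauge sum of order \<open>1 / n\<close> and with
  diameters of order \<open>1 / l ^ n\<close>.
\<close>

lemma hausdorff_measure_heavy_eq_0:
  assumes d: "d > 0"
    and heavy: "\<And>x n. x \<in> E \<Longrightarrow> \<exists>N\<ge>n. \<exists>w\<in>W N. \<mu> w \<ge> real N ^ 3 * real l powr (- d * real N) \<and> x \<in> c w"
  shows "hausdorff_measure d E = 0"
proof -
  define K where "K = real CARD('d) powr d"
  define Inf\<delta> where "Inf\<delta> \<delta> = (INF U \<in> {U :: nat \<Rightarrow> (real ^ 'd) set. E \<subseteq> (\<Union>i. U i) \<and>
      (\<forall>i. bounded (U i) \<and> diameter (U i) \<le> \<delta>)}. \<Sum>i. hausdorff_gauge d (U i))" for \<delta>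
  have cover: "Inf\<delta> \<delta> \<le> ennreal (K / real n)"
    if \<delta>: "\<delta> > 0" and n: "n \<ge> 1" "real CARD('d) / real l ^ n \<le> \<delta>" for \<delta> n
  proof -
    let ?M = "first_heavy_words d n"
    have M: "w \<in> W (length w)" "length w \<ge> n"
      "\<mu> w \<ge> real (length w) ^ 3 * real l powr (- d * real (length w))" if "w \<in> ?M" for w
      using that by (auto simp: first_heavy_words_def heavy_words_def)
    \<comment> \<open>Covers are sequences of sets; words are enumerated through their natural number codes, and the empty set, which has gauge zero, fills the gaps.\<close>
    define U where "U i = (if i \<in> to_nat ` ?M then c (from_nat i) else {})" for i
    have U: "U i = {} \<or> (\<exists>w\<in>?M. i = to_nat w \<and> U i = c w)" for i
      by (auto simp: U_def)
    have "E \<subseteq> (\<Union>i. U i)"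
    proof
      fix x assume "x \<in> E"
      then obtain N w where w: "N \<ge> n" "w \<in> W N" "x \<in> c w"
        "\<mu> w \<ge> real N ^ 3 * real l powr (- d * real N)"
        using heavy by blast
      then have "w \<in> heavy_words d n"
        by (auto simp: heavy_words_def level_words_def)
      then obtain w' where "w' \<in> ?M" "x \<in> c w'"
        using first_heavy_words_cover w(3) by blast
      then have "x \<in> U (to_nat w')" by (simp add: U_def)
      then show "x \<in> (\<Union>i. U i)" by blast
    qed
    moreover have "bounded (U i) \<and> diameter (U i) \<le> \<delta>" for i
    proof (cases "U i = {}")
      case False
      then obtain w where w: "w \<in> ?M" "U i = c w" using U[of i] by blast
      obtain k where k: "c w = adic_cube l (length w) k" using cube_of_word[OF M(1)[OF w(1)]] .
      have "real CARD('d) / real l ^ length w \<le> real CARD('d) / real l ^ n"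
        using M(2)[OF w(1)] l by (intro divide_left_mono power_increasing) auto
      then show ?thesis
        using diameter_adic_cube[of l "length w" k] l n(2) unfolding w(2) k by auto
    qed (use \<delta> in simp)
    ultimately have "Inf\<delta> \<delta> \<le> (\<Sum>i. hausdorff_gauge d (U i))"
      unfolding Inf\<delta>_def by (intro INF_lower) auto
    also have "\<dots> \<le> (\<Sum>i. ennreal (K / real n) * emeasure m (U i))"
    proof (rule suminf_le)
      fix i
      show "hausdorff_gauge d (U i) \<le> ennreal (K / real n) * emeasure m (U i)"
      proof (cases "U i = {}")
        case False
        then obtain w where w: "w \<in> ?M" "U i = c w" using U[of i] by blast
        show ?thesis
          unfolding w(2) K_def by (rule hausdorff_gauge_cube_le[OF M(1)[OF w(1)] d M(2)[OF w(1)] n(1) M(3)[OF w(1)]])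
      qed (simp add: hausdorff_gauge_def)
    qed auto
    also have "\<dots> = ennreal (K / real n) * (\<Sum>i. emeasure m (U i))"
      by (rule ennreal_suminf_cmult)
    also have "(\<Sum>i. emeasure m (U i)) = emeasure m (\<Union>i. U i)"
    proof (rule suminf_emeasure)
      show "range U \<subseteq> sets m"
        using U sets_cube M(1) by (metis image_subsetI sets.empty_sets)
      show "disjoint_family U"
        unfolding disjoint_family_on_def
      proof (intro ballI impI equals0I)
        fix i j x assume ij: "i \<noteq> j" "x \<in> U i \<inter> U j"
        then obtain w w' where w: "w \<in> ?M" "i = to_nat w" "x \<in> c w" "w' \<in> ?M" "j = to_nat w'" "x \<in> c w'"
          using U[of i] U[of j] by blast
        then show False
          using first_heavy_words_unique[of w d n w' x] first_heavy_words_unique[of w' d n w x] ij(1)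
          by (metis nle_le)
      qed
    qed
    also have "ennreal (K / real n) * emeasure m (\<Union>i. U i) \<le> ennreal (K / real n) * 1"
      by (intro mult_left_mono) (auto simp: emeasure_le_1)
    finally show ?thesis by simp
  qed
  have "Inf\<delta> \<delta> \<le> 0" if \<delta>: "\<delta> > 0" for \<delta>
  proof (rule tendsto_lowerbound)
    have "(\<lambda>n. K / real n) \<longlonglongrightarrow> 0" by real_asymp
    then show "(\<lambda>n. ennreal (K / real n)) \<longlonglongrightarrow> 0"
      using tendsto_ennrealI by fastforce
    have "(\<lambda>n. real CARD('d) * (1 / real l) ^ n) \<longlonglongrightarrow> 0"
      using l by (intro tendsto_mult_right_zero LIMSEQ_power_zero) auto
    then have "eventually (\<lambda>n. real CARD('d) * (1 / real l) ^ n < \<delta>) sequentially"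
      using \<delta> by (rule order_tendstoD(2))
    then show "eventually (\<lambda>n. Inf\<delta> \<delta> \<le> ennreal (K / real n)) sequentially"
      using eventually_ge_at_top[of 1]
    proof eventually_elim
      case (elim n)
      then have "real CARD('d) / real l ^ n \<le> \<delta>" by (simp add: power_one_over)
      then show ?case using cover[OF \<delta>] elim(2) by blast
    qed
  qed simp
  then show ?thesis
    unfolding hausdorff_measure_def Inf\<delta>_def[symmetric] by (auto intro!: antisym SUP_least)
qed

text \<open>
  Positivity of the dimension has to be derived: with \<open>d \<le> 0\<close> a heavy cube of generation \<open>2\<close> or
  later would have mass at least \<open>8\<close>.
\<close>

lemma dimension_pos:
  assumes "\<exists>N\<ge>2. \<exists>w\<in>W N. \<mu> w \<ge> real N ^ 3 * real l powr (- d * real N)"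
  shows "d > 0"
proof (rule ccontr)
  assume "\<not> d > 0"
  obtain N w where N: "N \<ge> 2" "\<mu> w \<ge> real N ^ 3 * real l powr (- d * real N)"
    using assms by blast
  have "real l powr (- d * real N) \<ge> 1"
    using \<open>\<not> d > 0\<close> l by (intro ge_one_powr_ge_zero) (auto intro: mult_nonpos_nonneg)
  then have "2 ^ 3 * 1 \<le> real N ^ 3 * real l powr (- d * real N)"
    using N(1) by (intro mult_mono power_mono) auto
  then have "8 \<le> real N ^ 3 * real l powr (- d * real N)" by simp
  then show False using N(2) prob_le_1[of "c w"] by linarith
qed

section \<open>Singularity and absolute continuity\<close>

lemma null_hausdorff_and_packing_mass:
  assumes \<sigma>: "\<sigma> > 0"
    and exp: "(\<lambda>q. Lq_spectrum l m (1 - q) - (q * d + \<sigma>\<^sup>2 / 2 * q\<^sup>2)) \<in> o[at 0](\<lambda>q. q\<^sup>2)"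
  shows "\<exists>E\<in>sets borel. measure m E = 1 \<and> hausdorff_measure d E = 0"
    and "\<forall>E\<in>sets borel. packing_measure d E < \<infinity> \<longrightarrow> measure m E = 0"
proof -
  define heavy where "heavy x \<longleftrightarrow>
    (\<forall>n. \<exists>N\<ge>n. \<exists>w\<in>W N. \<mu> w \<ge> real N ^ 3 * real l powr (- d * real N) \<and> x \<in> c w)" for x
  obtain N where N: "\<And>x. x \<in> space m - N \<Longrightarrow> heavy x" "N \<in> null_sets m"
    by (rule AE_E3[OF AE_heavy_and_light_cubes(1)[OF \<sigma> exp, folded heavy_def]]) blast
  have one: "measure m (space m - N) = 1"
    using N(2) prob_compl[of N] by (simp add: null_sets_def measure_def)
  then have "space m - N \<noteq> {}" by (metis measure_empty zero_neq_one)
  then obtain x where "heavy x" using N(1) by blast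
  then have "d > 0"
    unfolding heavy_def by (intro dimension_pos) blast
  then have "hausdorff_measure d (space m - N) = 0"
    by (rule hausdorff_measure_heavy_eq_0) (use N(1) in \<open>auto simp: heavy_def\<close>)
  then show "\<exists>E\<in>sets borel. measure m E = 1 \<and> hausdorff_measure d E = 0"
    using one sets.compl_sets[OF null_setsD2[OF N(2)]] sets_m by blast
  show "\<forall>E\<in>sets borel. packing_measure d E < \<infinity> \<longrightarrow> measure m E = 0"
  proof (intro ballI impI)
    fix E :: "(real ^ 'd) set" assume E: "E \<in> sets borel" "packing_measure d E < \<infinity>"
    have "E \<in> null_sets m"
    proof (rule null_of_finite_packing_measure[OF sets_m])
      show "AE x in m. \<forall>\<epsilon>>0. \<forall>\<eta>>0. \<exists>r>0. 2 * r \<le> \<eta> \<and>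
          emeasure m (cball x (5 * r)) \<le> ennreal \<epsilon> * ennreal ((2 * r) powr d)"
        by (rule AE_small_balls[OF AE_heavy_and_light_cubes(2)[OF \<sigma> exp]])
      show "E \<in> sets m" using E(1) sets_m by simp
    qed (rule E(2))
    then show "measure m E = 0" by (simp add: null_sets_def measure_def)
  qed
qed

end

theorem corollary4p9:
  fixes l :: nat
    and c :: "nat list \<Rightarrow> (real ^ 'd) set"
    and m :: "(real ^ 'd) measure"
    and d :: real
  assumes "l \<ge> 2"
    and "adic_coding l c"
    and "quasi_bernoulli l c m"
    and "d = - deriv (Lq_spectrum l m) 1"
    and "\<exists>\<sigma>>0. (\<lambda>q. Lq_spectrum l m (1 - q) - (q * d + \<sigma>\<^sup>2 / 2 * q\<^sup>2)) \<in> o[at 0](\<lambda>q. q\<^sup>2)"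
  shows "(\<exists>E \<in> sets borel. measure m E = 1 \<and> hausdorff_measure d E = 0)
       \<and> singular_to m (hausdorff_measure d)
       \<and> (\<forall>E \<in> sets borel. packing_measure d E < \<infinity> \<longrightarrow> measure m E = 0)
       \<and> abs_cont_to m (packing_measure d)"
proof -
  obtain C where C: "prob_space m" "sets m = sets borel" "measure m unit_cube = 1" "C \<ge> 1"
    "\<forall>u \<in> words (l ^ CARD('d)). \<forall>v \<in> words (l ^ CARD('d)).
        1 / C * measure m (c u) * measure m (c v) \<le> measure m (c (u @ v)) \<and>
        measure m (c (u @ v)) \<le> C * measure m (c u) * measure m (c v)"
    using assms(3) unfolding quasi_bernoulli_def by blast
  interpret quasi_bernoulli_coding l "l ^ CARD('d)" c m C
    by (intro quasi_bernoulli_coding.intro assms(1,2) refl C(1-4)) (use C(5) in blast)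
  obtain \<sigma> where \<sigma>: "\<sigma> > 0"
    "(\<lambda>q. Lq_spectrum l m (1 - q) - (q * d + \<sigma>\<^sup>2 / 2 * q\<^sup>2)) \<in> o[at 0](\<lambda>q. q\<^sup>2)"
    using assms(5) by blast
  have hausdorff: "\<exists>E\<in>sets borel. measure m E = 1 \<and> hausdorff_measure d E = 0"
    and packing: "\<forall>E\<in>sets borel. packing_measure d E < \<infinity> \<longrightarrow> measure m E = 0"
    using null_hausdorff_and_packing_mass[OF \<sigma>] by blast+
  moreover have "singular_to m (hausdorff_measure d)"
    unfolding singular_to_def by (rule hausdorff)
  moreover have "abs_cont_to m (packing_measure d)"
    unfolding abs_cont_to_def using packing by simp
  ultimately show ?thesis by blast
qed

end
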